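(* Let $\bar X\in\mathbb{R}_{\ge0}^{m\times n}$ and suppose $(p,q)$ are the row and column sums of a draw from the biproportional Poisson model with base matrix $\bar X$ and true parameters $(u^*,v^* )$. Let $\mathcal L^*=-\nabla^2\ell(u^*,v^* )=\begin{bmatrix}\mathrm{diag}(W\mathbf 1_n)&-W\\-W^T&\mathrm{diag}(W^T\mathbf 1_m)\end{bmatrix}$, where $W_{ij}=e^{u^*_i}\bar X_{ij}e^{-v^*_j}$. If $\lambda_{-2}(\mathcal L^* )\ge 8\log(m+n)$, then with probability at least $1-2/\sqrt{m+n}$ the function $\ell$ has a finite maximizer that is unique up to the shift $(u,v)\mapsto(u+c\mathbf 1_m,v+c\mathbf 1_n)$, $c\in\mathbb{R}$ (i.e. a unique normalized finite maximizer), and IPF on $(\bar X,p,q)$ converges to this solution.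
   Context: Biproportional Poisson model: given $\bar X\in\mathbb{R}_{\ge0}^{m\times n}$ and $u\in\mathbb{R}^m$, $v\in\mathbb{R}^n$, entries $Y_{ij}$ are independent with $Y_{ij}\sim\mathrm{Poisson}(e^{u_i}\bar X_{ij}e^{-v_j})$ if $\bar X_{ij}>0$ and $Y_{ij}=0$ otherwise; $p_i=\sum_jY_{ij}$, $q_j=\sum_iY_{ij}$. Log-likelihood: $\ell(u,v)=\sum_ip_iu_i-\sum_jq_jv_j-\sum_{ij}\bar X_{ij}e^{u_i-v_j}$. $\lambda_{-2}(\cdot)$ denotes the second-smallest eigenvalue. IPF on $(X,p,q)$: start with $d^0=\mathbf 1_m$, $d^1=\mathbf 1_n$ and alternately set $d^0_i\leftarrow p_i/\sum_jX_{ij}d^1_j$ for all $i$, then $d^1_j\leftarrow q_j/\sum_iX_{ij}d^0_i$ for all $j$; the corresponding parameters are $(\log d^0,-\log d^1)$. *)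

theory Defs
  imports "HOL-Probability.Probability" "Jordan_Normal_Form.Char_Poly"
begin

definition bp_weight :: "(nat \<Rightarrow> nat \<Rightarrow> real) \<Rightarrow> (nat \<Rightarrow> real) \<Rightarrow> (nat \<Rightarrow> real) \<Rightarrow> nat \<Rightarrow> nat \<Rightarrow> real" where
  "bp_weight Xb u v i j = exp (u i) * Xb i j * exp (- v j)"

definition bp_poisson_model :: "nat \<Rightarrow> nat \<Rightarrow> (nat \<Rightarrow> nat \<Rightarrow> real) \<Rightarrow> (nat \<Rightarrow> real) \<Rightarrow> (nat \<Rightarrow> real)
    \<Rightarrow> (nat \<times> nat \<Rightarrow> nat) pmf" where
  "bp_poisson_model m n Xb u v =
     Pi_pmf {(i, j). i < m \<and> j < n \<and> Xb i j > 0} 0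
       (\<lambda>(i, j). poisson_pmf (bp_weight Xb u v i j))"

definition row_sums :: "nat \<Rightarrow> (nat \<times> nat \<Rightarrow> nat) \<Rightarrow> nat \<Rightarrow> real" where
  "row_sums n Y i = real (\<Sum>j<n. Y (i, j))"

definition col_sums :: "nat \<Rightarrow> (nat \<times> nat \<Rightarrow> nat) \<Rightarrow> nat \<Rightarrow> real" where
  "col_sums m Y j = real (\<Sum>i<m. Y (i, j))"

definition loglik :: "nat \<Rightarrow> nat \<Rightarrow> (nat \<Rightarrow> nat \<Rightarrow> real) \<Rightarrow> (nat \<Rightarrow> real) \<Rightarrow> (nat \<Rightarrow> real)
    \<Rightarrow> (nat \<Rightarrow> real) \<Rightarrow> (nat \<Rightarrow> real) \<Rightarrow> real" where
  "loglik m n Xb p q u v =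
     (\<Sum>i<m. p i * u i) - (\<Sum>j<n. q j * v j) - (\<Sum>i<m. \<Sum>j<n. Xb i j * exp (u i - v j))"

text \<open>The (m+n)x(m+n) matrix [diag(W 1) , -W ; -W^T , diag(W^T 1)].\<close>
definition bp_laplacian :: "nat \<Rightarrow> nat \<Rightarrow> (nat \<Rightarrow> nat \<Rightarrow> real) \<Rightarrow> real mat" where
  "bp_laplacian m n W = mat (m + n) (m + n) (\<lambda>(a, b).
     if a < m \<and> b < m then (if a = b then (\<Sum>j<n. W a j) else 0)
     else if a < m \<and> m \<le> b then - W a (b - m)
     else if m \<le> a \<and> b < m then - W b (a - m)
     else (if a = b then (\<Sum>i<m. W i (a - m)) else 0))"

text \<open>Second-smallest eigenvalue, counting algebraic multiplicities (roots of the
  characteristic polynomial); for a real symmetric matrix all eigenvalues are real.\<close>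
definition lambda_second_smallest :: "real mat \<Rightarrow> real" where
  "lambda_second_smallest A =
     (LEAST x. poly (char_poly A) x = 0 \<and>
        2 \<le> (\<Sum>y\<in>{y. poly (char_poly A) y = 0 \<and> y \<le> x}. order y (char_poly A)))"

definition is_maximizer :: "nat \<Rightarrow> nat \<Rightarrow> (nat \<Rightarrow> nat \<Rightarrow> real) \<Rightarrow> (nat \<Rightarrow> real) \<Rightarrow> (nat \<Rightarrow> real)
    \<Rightarrow> (nat \<Rightarrow> real) \<Rightarrow> (nat \<Rightarrow> real) \<Rightarrow> bool" where
  "is_maximizer m n Xb p q u v \<longleftrightarrow>
     (\<forall>u' v'. loglik m n Xb p q u' v' \<le> loglik m n Xb p q u v)"

fun ipf :: "nat \<Rightarrow> nat \<Rightarrow> (nat \<Rightarrow> nat \<Rightarrow> real) \<Rightarrow> (nat \<Rightarrow> real) \<Rightarrow> (nat \<Rightarrow> real)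
    \<Rightarrow> nat \<Rightarrow> (nat \<Rightarrow> real) \<times> (nat \<Rightarrow> real)" where
  "ipf m n X p q 0 = (\<lambda>_. 1, \<lambda>_. 1)"
| "ipf m n X p q (Suc k) =
     (let d1 = snd (ipf m n X p q k);
          d0' = (\<lambda>i. p i / (\<Sum>j<n. X i j * d1 j));
          d1' = (\<lambda>j. q j / (\<Sum>i<m. X i j * d0' i))
      in (d0', d1'))"

definition bp_good_event :: "nat \<Rightarrow> nat \<Rightarrow> (nat \<Rightarrow> nat \<Rightarrow> real) \<Rightarrow> (nat \<Rightarrow> real) \<Rightarrow> (nat \<Rightarrow> real) \<Rightarrow> bool" where
  "bp_good_event m n Xb p q \<longleftrightarrow>
     (\<exists>u v. is_maximizer m n Xb p q u v \<and>
        (\<forall>u' v'. is_maximizer m n Xb p q u' v' \<longrightarrow>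
           (\<exists>c. (\<forall>i<m. u' i = u i + c) \<and> (\<forall>j<n. v' j = v j + c))) \<and>
        (\<forall>i<m. (\<lambda>k. ln (fst (ipf m n Xb p q k) i)) \<longlonglongrightarrow> u i) \<and>
        (\<forall>j<n. (\<lambda>k. - ln (snd (ipf m n Xb p q k) j)) \<longlonglongrightarrow> v j))"

end

theory Submission
  imports Defs
begin

text \<open>A finite maximiser exists as soon as the digraph with an arc from column \<open>j\<close> to row \<open>i\<close> for
  every positive base entry, and from row \<open>i\<close> to column \<open>j\<close> for every positive observed entry, is
  strongly connected: on a superlevel set of the log-likelihood every summand
  \<open>Y (i, j) * z - Xb i j * exp z\<close> is bounded below, so \<open>u i - v j\<close> is bounded above on all arcs of the
  first kind and below on those of the second, and all parameters stay within bounded distance of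
  each other. A vertex set \<open>A\<close> has no outgoing arc with probability at most \<open>exp (- cut A)\<close>. Testing
  the Laplacian on the centred indicator of \<open>A\<close>, a set of size \<open>k\<close> among \<open>N = m + n\<close> vertices has cut
  at least \<open>8 * ln N * k * (N - k) / N\<close>, and a union bound over \<open>A\<close> gives the probability estimate.

  Relative to a maximiser, IPF alternates weighted arithmetic and harmonic means. The ranges of the
  iterates are nested, and a monotone weighted total forces neighbouring values together, so by
  connectedness all values approach a common constant.\<close>

section \<open>Spectral gap and cuts\<close>

lemma char_poly_two_eigenvectors:
  fixes A :: "'a :: field mat" and f g :: "nat \<Rightarrow> 'a"
  assumes A: "A \<in> carrier_mat N N"
    and f: "\<And>i. i < N \<Longrightarrow> (\<Sum>k<N. A $$ (i, k) * f k) = e * f i"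
    and g: "\<And>i. i < N \<Longrightarrow> (\<Sum>k<N. A $$ (i, k) * g k) = d * g i"
    and ab: "a < N" "b < N" and indep: "f a * g b \<noteq> f b * g a"
  shows "[:- e, 1:] * [:- d, 1:] dvd char_poly A"
proof -
  interpret const: comm_ring_hom "\<lambda>x :: 'a. [:x:]"
    by unfold_locales (auto simp: one_pCons)
  have neq: "a \<noteq> b" using indep by auto
  define P :: "'a mat" where
    "P = mat N N (\<lambda>(i, j). if j = a then f i else if j = b then g i else if i = j then 1 else 0)"
  define M where "M = char_poly_matrix A"
  define P' where "P' = map_mat (\<lambda>x. [:x:]) P"
  define D :: "'a poly mat" where
    "D = mat N N (\<lambda>(i, j). if i = j then (if i = a then [:- e, 1:] else if i = b then [:- d, 1:] else 1) else 0)"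
  define Q where "Q = mat N N (\<lambda>(i, j). if j = a then [:f i:] else if j = b then [:g i:] else M $$ (i, j))"
  have car: "P \<in> carrier_mat N N" "M \<in> carrier_mat N N" "P' \<in> carrier_mat N N"
    "D \<in> carrier_mat N N" "Q \<in> carrier_mat N N"
    using A by (auto simp: P_def M_def P'_def D_def Q_def)
  have entry: "M $$ (i, j) = (if i = j then [:0, 1:] else 0) - [:A $$ (i, j):]" if "i < N" "j < N" for i j
    using A that by (auto simp: M_def char_poly_matrix_def)
  have row: "(\<Sum>k<N. M $$ (i, k) * [:h k:]) = [:h i:] * [:- c, 1:]"
    if i: "i < N" and h: "(\<Sum>k<N. A $$ (i, k) * h k) = c * h i" for i h c
  proof -
    have "(\<Sum>k<N. M $$ (i, k) * [:h k:]) =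
        (\<Sum>k<N. (if i = k then [:0, h k:] else 0) - [:A $$ (i, k) * h k:])"
      using i by (intro sum.cong) (auto simp: entry mult_ac)
    also have "\<dots> = [:0, h i:] - [:\<Sum>k<N. A $$ (i, k) * h k:]"
      using i by (simp add: sum_subtractf const.hom_sum)
    finally show ?thesis using h by (simp add: mult_ac)
  qed
  \<comment> \<open>\<open>M\<close> maps the two columns \<open>f\<close>, \<open>g\<close> of the invertible constant matrix \<open>P\<close> to multiples of
    themselves, so \<open>det M * det P = det Q * det D\<close> exhibits both linear factors.\<close>
  have "M * P' = Q * D"
  proof (rule eq_matI)
    fix i j assume "i < dim_row (Q * D)" "j < dim_col (Q * D)"
    then have ij: "i < N" "j < N" using car by auto
    have L: "(M * P') $$ (i, j) = (\<Sum>k<N. M $$ (i, k) * [:P $$ (k, j):])"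
      using ij car by (auto simp: scalar_prod_def P'_def atLeast0LessThan intro!: sum.cong)
    have R: "(Q * D) $$ (i, j) = Q $$ (i, j) * D $$ (j, j)"
    proof -
      have "(Q * D) $$ (i, j) = (\<Sum>k<N. Q $$ (i, k) * D $$ (k, j))"
        using ij car by (auto simp: scalar_prod_def atLeast0LessThan intro!: sum.cong)
      also have "\<dots> = (\<Sum>k<N. if k = j then Q $$ (i, j) * D $$ (j, j) else 0)"
        using ij by (intro sum.cong) (auto simp: D_def)
      finally show ?thesis using ij by simp
    qed
    consider "j = a" | "j = b" | "j \<noteq> a" "j \<noteq> b" by blast
    then show "(M * P') $$ (i, j) = (Q * D) $$ (i, j)"
    proof cases
      case 1
      have "(M * P') $$ (i, j) = (\<Sum>k<N. M $$ (i, k) * [:f k:])"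
        unfolding L using 1 ij by (intro sum.cong) (auto simp: P_def)
      then show ?thesis unfolding R using row[OF ij(1) f[OF ij(1)]] 1 ij by (simp add: Q_def D_def)
    next
      case 2
      have "(M * P') $$ (i, j) = (\<Sum>k<N. M $$ (i, k) * [:g k:])"
        unfolding L using 2 ij neq by (intro sum.cong) (auto simp: P_def)
      then show ?thesis unfolding R using row[OF ij(1) g[OF ij(1)]] 2 ij neq by (simp add: Q_def D_def)
    next
      case 3
      have "(M * P') $$ (i, j) = (\<Sum>k<N. if k = j then M $$ (i, j) else 0)"
        unfolding L using 3 ij by (intro sum.cong) (auto simp: P_def)
      then show ?thesis unfolding R using 3 ij by (simp add: Q_def D_def)
    qed
  qed (use car in auto)
  then have "det M * det P' = det Q * det D"
    using car by (metis det_mult)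
  moreover have "det P' = [:det P:]"
    unfolding P'_def by (rule const.hom_det)
  moreover have "[:- e, 1:] * [:- d, 1:] dvd det D"
  proof -
    have "det D = prod_list (diag_mat D)"
      by (rule det_upper_triangular[OF _ car(4)]) (auto simp: D_def)
    also have "\<dots> = (\<Prod>i<N. D $$ (i, i))"
      using car by (simp add: prod_list_diag_prod atLeast0LessThan)
    also have "\<dots> = D $$ (a, a) * (D $$ (b, b) * (\<Prod>i\<in>{..<N} - {a} - {b}. D $$ (i, i)))"
      using ab neq by (subst prod.remove[of _ a], simp, simp, subst prod.remove[of _ b]) auto
    finally show ?thesis using ab neq by (simp add: D_def dvd_def ac_simps)
  qed
  ultimately have dv: "[:- e, 1:] * [:- d, 1:] dvd det M * [:det P:]" by (metis dvd_mult)
  have "det P \<noteq> 0"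
  proof
    assume "det P = 0"
    then obtain v where v: "v \<in> carrier_vec N" "v \<noteq> 0\<^sub>v N" "P *\<^sub>v v = 0\<^sub>v N"
      using det_0_iff_vec_prod_zero[OF car(1)] by auto
    let ?v = "vec_index v"
    have eq: "f i * ?v a + g i * ?v b + (if i = a \<or> i = b then 0 else ?v i) = 0" if i: "i < N" for i
    proof -
      have "0 = vec_index (P *\<^sub>v v) i" using v i by simp
      also have "\<dots> = (\<Sum>k<N. P $$ (i, k) * ?v k)"
        using i v(1) car by (auto simp: scalar_prod_def atLeast0LessThan intro!: sum.cong)
      also have "\<dots> = (\<Sum>k<N. (if k = a then f i * ?v a else 0) + (if k = b then g i * ?v b else 0)
          + (if k = i then (if i = a \<or> i = b then 0 else ?v i) else 0))"
        using i neq by (intro sum.cong) (auto simp: P_def)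
      also have "\<dots> = f i * ?v a + g i * ?v b + (if i = a \<or> i = b then 0 else ?v i)"
        using i ab by (simp add: sum.distrib)
      finally show ?thesis by simp
    qed
    have 1: "f a * ?v a + g a * ?v b = 0" and 2: "f b * ?v a + g b * ?v b = 0"
      using eq[OF ab(1)] eq[OF ab(2)] by auto
    have "(f a * g b - f b * g a) * ?v a = g b * (f a * ?v a + g a * ?v b) - g a * (f b * ?v a + g b * ?v b)"
      "(f a * g b - f b * g a) * ?v b = f a * (f b * ?v a + g b * ?v b) - f b * (f a * ?v a + g a * ?v b)"
      by (simp_all add: algebra_simps)
    then have va: "?v a = 0" "?v b = 0" using 1 2 indep by auto
    have "v = 0\<^sub>v N"
    proof (rule eq_vecI)
      fix i assume "i < dim_vec (0\<^sub>v N :: 'a vec)"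
      then show "?v i = vec_index (0\<^sub>v N) i" using eq[of i] va by (auto split: if_splits)
    qed (use v in auto)
    then show False using v by simp
  qed
  then show ?thesis using dv unfolding char_poly_def M_def by (simp add: dvd_smult_iff)
qed

lemma lambda_second_smallest_le:
  assumes A: "A \<in> carrier_mat N N" and le: "e \<le> d"
    and dv: "[:- e, 1:] * [:- d, 1:] dvd char_poly A"
  shows "lambda_second_smallest A \<le> d"
proof -
  let ?p = "char_poly A"
  let ?S = "\<lambda>x. {y. poly ?p y = 0 \<and> y \<le> x}"
  let ?P = "\<lambda>x. poly ?p x = 0 \<and> 2 \<le> (\<Sum>y\<in>?S x. order y ?p)"
  have p0: "?p \<noteq> 0" using degree_monic_char_poly[OF A] by auto
  then have fin: "finite {y. poly ?p y = 0}" by (rule poly_roots_finite)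
  have finS: "finite (?S x)" for x by (rule finite_subset[OF _ fin]) auto
  have "[:- e, 1:] dvd ?p" "[:- d, 1:] dvd ?p"
    using dv by (metis dvd_mult_left, metis dvd_mult_right)
  then have roots: "poly ?p e = 0" "poly ?p d = 0"
    by (simp_all add: poly_eq_0_iff_dvd)
  have "?P d"
  proof (cases "e = d")
    case True
    then have "[:- d, 1:] ^ 2 dvd ?p" using dv by (simp add: power2_eq_square)
    then have "2 \<le> order d ?p" using p0 by (simp add: order_divides)
    also have "\<dots> \<le> (\<Sum>y\<in>?S d. order y ?p)"
      by (rule member_le_sum) (use finS roots in auto)
    finally show ?thesis using roots by simp
  next
    case False
    have "2 \<le> order e ?p + order d ?p"
      using roots p0 by (metis One_nat_def Suc_1 Suc_leI add_mono bot_nat_0.not_eq_extremum one_add_one order_root)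
    also have "\<dots> = (\<Sum>y\<in>{e, d}. order y ?p)" using False by simp
    also have "\<dots> \<le> (\<Sum>y\<in>?S d. order y ?p)"
      by (rule sum_mono2) (use finS roots le in auto)
    finally show ?thesis using roots by simp
  qed
  moreover have "finite {x. ?P x}" by (rule finite_subset[OF _ fin]) auto
  ultimately have "(LEAST x. ?P x) \<le> d"
    by (subst Least_Min) auto
  then show ?thesis by (simp add: lambda_second_smallest_def)
qed

lemma compact_box_fun:
  fixes B :: real
  shows "compact {x :: nat \<Rightarrow> real. (\<forall>a<N. \<bar>x a\<bar> \<le> B) \<and> (\<forall>a\<ge>N. x a = 0)}" (is "compact ?K")
proof -
  have "?K = PiE UNIV (\<lambda>a. if a < N then {-B..B} else {0})"
    by (auto simp: PiE_def Pi_def abs_le_iff not_less split: if_splits)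
  moreover have "compactin (product_topology (\<lambda>i. euclidean) UNIV)
      (PiE UNIV (\<lambda>a. if a < N then {-B..B} else {0 :: real}))"
    unfolding compactin_PiE by auto
  ultimately show ?thesis
    by (simp add: euclidean_product_topology)
qed

definition graph_laplacian :: "nat \<Rightarrow> (nat \<Rightarrow> nat \<Rightarrow> real) \<Rightarrow> real mat" where
  "graph_laplacian N w = mat N N (\<lambda>(a, b). (if a = b then (\<Sum>c<N. w a c) else 0) - w a b)"

lemma graph_laplacian_carrier [simp]: "graph_laplacian N w \<in> carrier_mat N N"
  by (simp add: graph_laplacian_def)

lemma graph_laplacian_mult:
  assumes "a < N"
  shows "(\<Sum>b<N. graph_laplacian N w $$ (a, b) * x b) = (\<Sum>b<N. w a b * (x a - x b))"
proof -
  have "(\<Sum>b<N. graph_laplacian N w $$ (a, b) * x b) =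
      (\<Sum>b<N. (if b = a then (\<Sum>c<N. w a c) * x a else 0) - w a b * x b)"
    using assms by (intro sum.cong) (auto simp: graph_laplacian_def algebra_simps)
  also have "\<dots> = (\<Sum>c<N. w a c) * x a - (\<Sum>b<N. w a b * x b)"
    using assms by (simp add: sum_subtractf)
  finally show ?thesis by (simp add: algebra_simps sum_subtractf sum_distrib_left)
qed

lemma laplacian_form:
  fixes w :: "nat \<Rightarrow> nat \<Rightarrow> real"
  assumes sym: "\<And>a b. w a b = w b a"
  shows "(\<Sum>a<N. \<Sum>b<N. w a b * ((x a - x b) * (y a - y b))) = 2 * (\<Sum>a<N. y a * (\<Sum>b<N. w a b * (x a - x b)))"
proof -
  have "(\<Sum>a<N. \<Sum>b<N. w a b * ((x a - x b) * (y a - y b)))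
      = (\<Sum>a<N. \<Sum>b<N. y a * (w a b * (x a - x b))) + (\<Sum>a<N. \<Sum>b<N. y b * (w a b * (x b - x a)))"
    by (simp add: sum.distrib[symmetric] algebra_simps)
  also have "(\<Sum>a<N. \<Sum>b<N. y b * (w a b * (x b - x a))) = (\<Sum>b<N. \<Sum>a<N. y b * (w b a * (x b - x a)))"
    by (subst sum.swap) (simp add: sym)
  finally show ?thesis by (simp add: sum_distrib_left)
qed

lemma linear_le_quadratic_imp_zero:
  fixes b c :: real
  assumes "\<And>t. 0 \<le> 2 * t * b + t\<^sup>2 * c"
  shows "b = 0"
proof (rule ccontr)
  assume b: "b \<noteq> 0"
  define d where "d = \<bar>c\<bar> + 1"
  have d: "0 < d" "c \<le> d" by (auto simp: d_def)
  define r where "r = b / d"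
  have r: "r \<noteq> 0" "b = r * d" using b d by (auto simp: r_def)
  have "r\<^sup>2 * c \<le> r\<^sup>2 * d" using d by (intro mult_left_mono) auto
  moreover have "0 < r\<^sup>2 * d" using r d by simp
  moreover have "2 * (- r) * b + (- r)\<^sup>2 * c = r\<^sup>2 * c - 2 * (r\<^sup>2 * d)"
    unfolding r(2) by (simp add: power2_eq_square)
  ultimately show False using assms[of "- r"] by linarith
qed

lemma laplacian_second_eigenvector:
  fixes w :: "nat \<Rightarrow> nat \<Rightarrow> real"
  assumes sym: "\<And>a b. w a b = w b a" and nonneg: "\<And>a b. 0 \<le> w a b" and N: "2 \<le> N"
  obtains f :: "nat \<Rightarrow> real" and \<mu> :: real
  where "0 \<le> \<mu>" "(\<Sum>a<N. f a) = 0" "(\<Sum>a<N. (f a)\<^sup>2) = 1"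
    "\<And>a. a < N \<Longrightarrow> (\<Sum>b<N. w a b * (f a - f b)) = \<mu> * f a"
    "\<And>x. (\<Sum>a<N. x a) = 0 \<Longrightarrow> \<mu> * (\<Sum>a<N. (x a)\<^sup>2) \<le> (\<Sum>a<N. \<Sum>b<N. w a b * (x a - x b)\<^sup>2) / 2"
proof -
  define Q where "Q x = (\<Sum>a<N. \<Sum>b<N. w a b * (x a - x b)\<^sup>2) / 2" for x :: "nat \<Rightarrow> real"
  define K where "K = {x. (\<forall>a<N. \<bar>x a\<bar> \<le> 1) \<and> (\<forall>a\<ge>N. x a = 0)} \<inter>
    {x :: nat \<Rightarrow> real. (\<Sum>a<N. x a) = 0} \<inter> {x. (\<Sum>a<N. (x a)\<^sup>2) = 1}"
  have co: "continuous_on S (\<lambda>x :: nat \<Rightarrow> real. x a)" for S a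
    by (rule continuous_on_subset[OF continuous_on_product_coordinates]) auto
  have "compact K"
    unfolding K_def
    by (intro compact_Int_closed compact_box_fun closed_Collect_eq continuous_intros co)
  have normalise: "(\<lambda>a. if a < N then x a / sqrt (\<Sum>a<N. (x a)\<^sup>2) else 0) \<in> K"
    if x: "(\<Sum>a<N. x a) = 0" "(\<Sum>a<N. (x a)\<^sup>2) \<noteq> 0" for x
  proof -
    let ?r = "sqrt (\<Sum>a<N. (x a)\<^sup>2)"
    have r: "0 < ?r" using x(2) by (simp add: less_le sum_nonneg)
    have "\<bar>x a\<bar> \<le> ?r" if "a < N" for a
    proof -
      have "(x a)\<^sup>2 \<le> (\<Sum>a<N. (x a)\<^sup>2)" by (rule member_le_sum) (use that in auto)
      then show ?thesis by (metis real_sqrt_abs real_sqrt_le_iff)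
    qed
    then show ?thesis using r x
      by (auto simp: K_def sum_divide_distrib[symmetric] power_divide sum_nonneg)
  qed
  have "K \<noteq> {}"
  proof -
    define x where "x a = (if a = (0::nat) then 1 else 0) - (if a = 1 then 1 else (0::real))" for a
    have "(\<Sum>a<N. x a) = 0" using N by (simp add: x_def sum_subtractf)
    moreover have "(x 0)\<^sup>2 \<le> (\<Sum>a<N. (x a)\<^sup>2)" by (rule member_le_sum) (use N in auto)
    then have "(\<Sum>a<N. (x a)\<^sup>2) \<noteq> 0" by (simp add: x_def)
    ultimately show ?thesis using normalise[of x] by blast
  qed
  moreover have "continuous_on K Q"
    unfolding Q_def by (intro continuous_intros co) auto
  ultimately obtain f where f: "f \<in> K" and min: "\<And>x. x \<in> K \<Longrightarrow> Q f \<le> Q x"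
    using continuous_attains_inf[OF \<open>compact K\<close>] by metis
  define \<mu> where "\<mu> = Q f"
  have Q0: "0 \<le> Q x" for x by (simp add: Q_def nonneg sum_nonneg)
  have f1: "(\<Sum>a<N. f a) = 0" "(\<Sum>a<N. (f a)\<^sup>2) = 1" using f by (auto simp: K_def)
  have var: "\<mu> * (\<Sum>a<N. (x a)\<^sup>2) \<le> Q x" if x: "(\<Sum>a<N. x a) = 0" for x
  proof (cases "(\<Sum>a<N. (x a)\<^sup>2) = 0")
    case True
    then show ?thesis using Q0 by simp
  next
    case False
    let ?s = "\<Sum>a<N. (x a)\<^sup>2"
    have s: "0 < ?s" using False by (simp add: less_le sum_nonneg)
    have "\<mu> \<le> Q (\<lambda>a. if a < N then x a / sqrt ?s else 0)"
      unfolding \<mu>_def by (intro min normalise x False)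
    also have "\<dots> = (\<Sum>a<N. \<Sum>b<N. (w a b * (x a - x b)\<^sup>2) / ?s) / 2"
      unfolding Q_def using s
      by (intro arg_cong[where f = "\<lambda>z. z / 2"] sum.cong refl)
        (simp add: diff_divide_distrib[symmetric] power_divide)
    also have "\<dots> = Q x / ?s" by (simp add: Q_def sum_divide_distrib[symmetric])
    finally show ?thesis using s by (simp add: field_simps)
  qed
  \<comment> \<open>The residual \<open>R\<close> has mean zero and, by minimality of \<open>f\<close>, is orthogonal to every mean-zero
    vector; hence it is orthogonal to itself.\<close>
  define R where "R a = (\<Sum>b<N. w a b * (f a - f b)) - \<mu> * f a" for a
  have sumR: "(\<Sum>a<N. R a) = 0"
    using laplacian_form[of w f "\<lambda>_. 1" N, OF sym] f1
    by (simp add: R_def sum_subtractf sum_distrib_left[symmetric])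
  have orth: "(\<Sum>a<N. y a * R a) = 0" if y: "(\<Sum>a<N. y a) = 0" for y
  proof (rule linear_le_quadratic_imp_zero)
    fix t :: real
    let ?B = "\<lambda>x y. (\<Sum>a<N. \<Sum>b<N. w a b * ((x a - x b) * (y a - y b)))"
    have "\<mu> * (\<Sum>a<N. (f a + t * y a)\<^sup>2) \<le> Q (\<lambda>a. f a + t * y a)"
      using f1 y by (intro var) (simp add: sum.distrib sum_distrib_left[symmetric])
    also have "Q (\<lambda>a. f a + t * y a) = Q f + t * ?B f y + t\<^sup>2 * Q y"
    proof -
      have "Q (\<lambda>a. f a + t * y a) = (\<Sum>a<N. \<Sum>b<N. w a b * (f a - f b)\<^sup>2
          + 2 * t * (w a b * ((f a - f b) * (y a - y b))) + t\<^sup>2 * (w a b * (y a - y b)\<^sup>2)) / 2"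
        unfolding Q_def
        by (intro arg_cong[where f = "\<lambda>z. z / 2"] sum.cong refl) (simp add: power2_eq_square algebra_simps)
      then show ?thesis by (simp add: sum.distrib sum_distrib_left[symmetric] Q_def add_divide_distrib)
    qed
    also have "?B f y = 2 * (\<Sum>a<N. y a * R a) + 2 * \<mu> * (\<Sum>a<N. f a * y a)"
      unfolding laplacian_form[of w f y N, OF sym]
      by (simp add: R_def sum_subtractf right_diff_distrib sum_distrib_left mult_ac)
    also have "(\<Sum>a<N. (f a + t * y a)\<^sup>2) = 1 + 2 * t * (\<Sum>a<N. f a * y a) + t\<^sup>2 * (\<Sum>a<N. (y a)\<^sup>2)"
    proof -
      have "(\<Sum>a<N. (f a + t * y a)\<^sup>2) = (\<Sum>a<N. (f a)\<^sup>2 + 2 * t * (f a * y a) + t\<^sup>2 * (y a)\<^sup>2)"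
        by (intro sum.cong refl) (simp add: power2_eq_square algebra_simps)
      then show ?thesis by (simp add: sum.distrib sum_distrib_left[symmetric] f1)
    qed
    finally show "0 \<le> 2 * t * (\<Sum>a<N. y a * R a) + t\<^sup>2 * (Q y - \<mu> * (\<Sum>a<N. (y a)\<^sup>2))"
      by (simp add: \<mu>_def algebra_simps)
  qed
  have "(\<Sum>a<N. (R a)\<^sup>2) = 0" using orth[OF sumR] by (simp add: power2_eq_square)
  then have "\<forall>a\<in>{..<N}. (R a)\<^sup>2 = 0" by (subst (asm) sum_nonneg_eq_0_iff) auto
  then have eig: "(\<Sum>b<N. w a b * (f a - f b)) = \<mu> * f a" if "a < N" for a
    using that by (simp add: R_def)
  show thesis
    by (rule that[of \<mu> f]) (use f1 eig var Q0 in \<open>auto simp: \<mu>_def Q_def\<close>)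
qed

lemma second_eigenvalue_le_cut:
  fixes w :: "nat \<Rightarrow> nat \<Rightarrow> real"
  assumes sym: "\<And>a b. w a b = w b a" and nonneg: "\<And>a b. 0 \<le> w a b"
    and A: "A \<subseteq> {..<N}" "A \<noteq> {}" "A \<noteq> {..<N}"
  shows "lambda_second_smallest (graph_laplacian N w) * (real (card A) * real (N - card A) / real N)
    \<le> (\<Sum>a\<in>A. \<Sum>b\<in>{..<N} - A. w a b)"
proof -
  have finA: "finite A" using A by (auto intro: finite_subset)
  have cA: "0 < card A" "card A < N"
    using A finA psubset_card_mono[of "{..<N}" A] by (auto simp: card_gt_0_iff)
  then have N: "2 \<le> N" by linarith
  define k where "k = real (card A)"
  have k: "0 < k" "k < real N" "real (N - card A) = real N - k" using cA by (auto simp: k_def)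
  obtain f :: "nat \<Rightarrow> real" and \<mu> where f: "0 \<le> \<mu>" "(\<Sum>a<N. f a) = 0" "(\<Sum>a<N. (f a)\<^sup>2) = 1"
    and eig: "\<And>a. a < N \<Longrightarrow> (\<Sum>b<N. w a b * (f a - f b)) = \<mu> * f a"
    and var: "\<And>x. (\<Sum>a<N. x a) = 0 \<Longrightarrow> \<mu> * (\<Sum>a<N. (x a)\<^sup>2) \<le> (\<Sum>a<N. \<Sum>b<N. w a b * (x a - x b)\<^sup>2) / 2"
    by (rule laplacian_second_eigenvector[OF sym nonneg N]) (rule that)
  have "\<exists>a<N. \<exists>b<N. f a \<noteq> f b"
  proof (rule ccontr)
    assume nex: "\<not> ?thesis"
    have "0 < N" using N by simp
    with nex have "\<forall>a<N. f a = f 0" by blast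
    then obtain c where eq: "\<And>a. a < N \<Longrightarrow> f a = c" by blast
    then have "real N * c = 0" using f by simp
    then have "c = 0" using N by simp
    then have "(\<Sum>a<N. (f a)\<^sup>2) = 0" using eq by simp
    then show False using f by simp
  qed
  then obtain a b where ab: "a < N" "b < N" "f a \<noteq> f b" by blast
  have "[:- 0, 1:] * [:- \<mu>, 1:] dvd char_poly (graph_laplacian N w)"
  proof (rule char_poly_two_eigenvectors[where f = "\<lambda>_. 1" and g = f])
    fix i assume i: "i < N"
    show "(\<Sum>k<N. graph_laplacian N w $$ (i, k) * 1) = 0 * 1"
      unfolding graph_laplacian_mult[OF i] by simp
    show "(\<Sum>k<N. graph_laplacian N w $$ (i, k) * f k) = \<mu> * f i"
      unfolding graph_laplacian_mult[OF i] by (rule eig[OF i])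
  qed (use ab in auto)
  then have lam: "lambda_second_smallest (graph_laplacian N w) \<le> \<mu>"
    by (intro lambda_second_smallest_le[OF graph_laplacian_carrier f(1)]) simp
  define x where "x a = (if a \<in> A then 1 else 0) - k / real N" for a
  have sA: "(\<Sum>a<N. if a \<in> A then c else 0) = k * c" for c
    using A by (simp add: sum.If_cases k_def Int_absorb1)
  have x0: "(\<Sum>a<N. x a) = 0" using N sA[of 1] by (simp add: x_def sum_subtractf)
  have x2: "(\<Sum>a<N. (x a)\<^sup>2) = k * (real N - k) / real N"
  proof -
    have "(\<Sum>a<N. (x a)\<^sup>2) = (\<Sum>a<N. (if a \<in> A then 1 - 2 * (k / real N) else 0) + (k / real N)\<^sup>2)"
      by (intro sum.cong refl) (simp add: x_def power2_eq_square algebra_simps)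
    also have "\<dots> = k * (real N - k) / real N"
      using N by (simp add: sum.distrib sA) (simp add: field_simps power2_eq_square)
    finally show ?thesis .
  qed
  have xw: "(\<Sum>a<N. \<Sum>b<N. w a b * (x a - x b)\<^sup>2) = 2 * (\<Sum>a\<in>A. \<Sum>b\<in>{..<N} - A. w a b)"
  proof -
    let ?C = "{..<N} - A"
    have split: "(\<Sum>a<N. g a) = (\<Sum>a\<in>A. g a) + (\<Sum>a\<in>?C. g a)" for g :: "nat \<Rightarrow> real"
      using A by (metis add.commute finite_lessThan sum.subset_diff)
    have "(\<Sum>a<N. \<Sum>b<N. w a b * (x a - x b)\<^sup>2) = (\<Sum>a\<in>A. \<Sum>b\<in>?C. w a b) + (\<Sum>a\<in>?C. \<Sum>b\<in>A. w a b)"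
    proof -
      let ?d = "\<lambda>a b. w a b * (x a - x b)\<^sup>2"
      have "(\<Sum>a\<in>A. \<Sum>b\<in>A. ?d a b) = 0" "(\<Sum>a\<in>?C. \<Sum>b\<in>?C. ?d a b) = 0"
        by (intro sum.neutral ballI; simp add: x_def)+
      moreover have "(\<Sum>a\<in>A. \<Sum>b\<in>?C. ?d a b) = (\<Sum>a\<in>A. \<Sum>b\<in>?C. w a b)"
        "(\<Sum>a\<in>?C. \<Sum>b\<in>A. ?d a b) = (\<Sum>a\<in>?C. \<Sum>b\<in>A. w a b)"
        by (intro sum.cong refl; simp add: x_def)+
      ultimately show ?thesis
        unfolding split by (simp only: sum.distrib)
    qed
    moreover have "(\<Sum>a\<in>?C. \<Sum>b\<in>A. w a b) = (\<Sum>b\<in>A. \<Sum>a\<in>?C. w b a)"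
      by (subst sum.swap) (simp add: sym)
    ultimately show ?thesis by simp
  qed
  have "\<mu> * (k * (real N - k) / real N) \<le> (\<Sum>a\<in>A. \<Sum>b\<in>{..<N} - A. w a b)"
    using var[OF x0] unfolding x2 xw by simp
  moreover have "lambda_second_smallest (graph_laplacian N w) * (k * (real N - k) / real N) \<le> \<mu> * (k * (real N - k) / real N)"
    using k by (intro mult_right_mono lam) auto
  ultimately show ?thesis by (simp add: k(3) k_def[symmetric])
qed

section \<open>Probability of a blocked vertex set\<close>

definition bip_weight :: "nat \<Rightarrow> nat \<Rightarrow> (nat \<Rightarrow> nat \<Rightarrow> real) \<Rightarrow> nat \<Rightarrow> nat \<Rightarrow> real" where
  "bip_weight m n W a b =
    (if a < m \<and> m \<le> b \<and> b < m + n then W a (b - m)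
     else if b < m \<and> m \<le> a \<and> a < m + n then W b (a - m) else 0)"

lemma bip_weight_simps [simp]:
  "i < m \<Longrightarrow> i' < m \<Longrightarrow> bip_weight m n W i i' = 0"
  "i < m \<Longrightarrow> j < n \<Longrightarrow> bip_weight m n W i (m + j) = W i j"
  "i < m \<Longrightarrow> j < n \<Longrightarrow> bip_weight m n W (m + j) i = W i j"
  "bip_weight m n W (m + j) (m + j') = 0"
  by (simp_all add: bip_weight_def)

lemma sum_lessThan_add:
  fixes g :: "nat \<Rightarrow> 'a :: comm_monoid_add"
  shows "(\<Sum>c<m + n. g c) = (\<Sum>i<m. g i) + (\<Sum>j<n. g (m + j))"
  by (induction n) (simp_all add: add.assoc)

lemma bp_laplacian_eq: "bp_laplacian m n W = graph_laplacian (m + n) (bip_weight m n W)"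
proof (rule eq_matI)
  fix a b
  assume "a < dim_row (graph_laplacian (m + n) (bip_weight m n W))"
    "b < dim_col (graph_laplacian (m + n) (bip_weight m n W))"
  then have ab: "a < m + n" "b < m + n" by (auto simp: graph_laplacian_def)
  have "(\<Sum>c<m + n. bip_weight m n W a c) = (if a < m then (\<Sum>j<n. W a j) else (\<Sum>i<m. W i (a - m)))"
    using ab by (auto simp: sum_lessThan_add bip_weight_def)
  then show "bp_laplacian m n W $$ (a, b) = graph_laplacian (m + n) (bip_weight m n W) $$ (a, b)"
    using ab by (auto simp: bp_laplacian_def graph_laplacian_def bip_weight_def)
qed (auto simp: bp_laplacian_def graph_laplacian_def)

lemma bip_cut:
  assumes A: "A \<subseteq> {..<m + n}"
  shows "(\<Sum>a\<in>A. \<Sum>b\<in>{..<m + n} - A. bip_weight m n W a b) =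
    (\<Sum>i<m. \<Sum>j<n. if (i \<in> A) \<noteq> (m + j \<in> A) then W i j else 0)"
proof -
  have ind: "sum g A = (\<Sum>a<m + n. if a \<in> A then g a else 0)"
    "sum g ({..<m + n} - A) = (\<Sum>a<m + n. if a \<notin> A then g a else 0)" for g :: "nat \<Rightarrow> real"
    using A by (auto simp: sum.If_cases Int_absorb1 Diff_eq Compl_eq)
  have "(\<Sum>a\<in>A. \<Sum>b\<in>{..<m + n} - A. bip_weight m n W a b) =
      (\<Sum>i<m. \<Sum>j<n. if i \<in> A \<and> m + j \<notin> A then W i j else 0) +
      (\<Sum>j<n. \<Sum>i<m. if m + j \<in> A \<and> i \<notin> A then W i j else 0)"
    unfolding ind sum_lessThan_add
    by (intro arg_cong2[where f = "(+)"] sum.cong refl) (auto cong: sum.cong_simp if_cong)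
  also have "(\<Sum>j<n. \<Sum>i<m. if m + j \<in> A \<and> i \<notin> A then W i j else 0) =
      (\<Sum>i<m. \<Sum>j<n. if m + j \<in> A \<and> i \<notin> A then W i j else 0)"
    by (rule sum.swap)
  finally show ?thesis
    unfolding sum.distrib[symmetric] by (auto intro!: sum.cong)
qed

text \<open>Vertex \<open>i < m\<close> is row \<open>i\<close> and vertex \<open>m + j\<close> is column \<open>j\<close>. Orient an edge from column \<open>j\<close> to
  row \<open>i\<close> when \<open>Xb i j \<noteq> 0\<close>, and from row \<open>i\<close> to column \<open>j\<close> when \<open>Y (i, j) \<noteq> 0\<close>; \<open>A\<close> is blocked if
  no oriented edge leaves it.\<close>

definition blocked :: "nat \<Rightarrow> nat \<Rightarrow> (nat \<Rightarrow> nat \<Rightarrow> real) \<Rightarrow> (nat \<times> nat \<Rightarrow> 'a :: zero) \<Rightarrow> nat set \<Rightarrow> bool" where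
  "blocked m n Xb Y A \<longleftrightarrow> (\<forall>i<m. \<forall>j<n.
     (m + j \<in> A \<and> i \<notin> A \<longrightarrow> Xb i j = 0) \<and> (i \<in> A \<and> m + j \<notin> A \<longrightarrow> Y (i, j) = 0))"

lemma prob_poisson_zero: "0 < r \<Longrightarrow> measure_pmf.prob (poisson_pmf r) {0} = exp (- r)"
  by (simp add: measure_pmf_single)

lemma finite_bp_support: "finite {(i, j). i < (m::nat) \<and> j < (n::nat) \<and> 0 < (Xb i j :: real)}"
  by (rule finite_subset[of _ "{..<m} \<times> {..<n}"]) auto

lemma prob_blocked_le:
  assumes A: "A \<subseteq> {..<m + n}" and nonneg: "\<forall>i<m. \<forall>j<n. 0 \<le> Xb i j"
  shows "measure_pmf.prob (bp_poisson_model m n Xb u v) {Y. blocked m n Xb Y A}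
    \<le> exp (- (\<Sum>a\<in>A. \<Sum>b\<in>{..<m + n} - A. bip_weight m n (bp_weight Xb u v) a b))"
proof (cases "\<forall>i<m. \<forall>j<n. m + j \<in> A \<and> i \<notin> A \<longrightarrow> Xb i j = 0")
  case False
  then have "{Y :: nat \<times> nat \<Rightarrow> nat. blocked m n Xb Y A} = {}" by (auto simp: blocked_def)
  then show ?thesis by simp
next
  case True
  let ?S = "{(i, j). i < m \<and> j < n \<and> 0 < Xb i j}"
  let ?W = "bp_weight Xb u v"
  let ?B = "\<lambda>(i, j). if i \<in> A \<and> m + j \<notin> A then {0 :: nat} else UNIV"
  let ?g = "\<lambda>(i, j). if (i \<in> A) \<noteq> (m + j \<in> A) then ?W i j else 0"
  have W0: "Xb i j = 0 \<Longrightarrow> ?W i j = 0" and Wpos: "0 < Xb i j \<Longrightarrow> 0 < ?W i j" for i j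
    by (simp_all add: bp_weight_def)
  have "measure_pmf.prob (bp_poisson_model m n Xb u v) {Y. blocked m n Xb Y A} \<le>
      measure_pmf.prob (bp_poisson_model m n Xb u v) (Pi ?S ?B)"
    by (rule measure_pmf.finite_measure_mono) (auto simp: blocked_def)
  also have "\<dots> = (\<Prod>x\<in>?S. measure_pmf.prob ((\<lambda>(i, j). poisson_pmf (?W i j)) x) (?B x))"
    unfolding bp_poisson_model_def by (rule measure_Pi_pmf_Pi[OF finite_bp_support])
  also have "\<dots> = (\<Prod>x\<in>?S. exp (- ?g x))"
  proof (rule prod.cong[OF refl])
    fix x assume "x \<in> ?S"
    then obtain i j where x: "x = (i, j)" and ij: "i < m" "j < n" "0 < Xb i j" by auto
    then have "\<not> (m + j \<in> A \<and> i \<notin> A)" using True by force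
    then show "measure_pmf.prob ((\<lambda>(i, j). poisson_pmf (?W i j)) x) (?B x) = exp (- ?g x)"
      using prob_poisson_zero[OF Wpos[OF ij(3)]] by (auto simp: x)
  qed
  also have "\<dots> = exp (- (\<Sum>x\<in>?S. ?g x))"
    by (simp add: exp_sum[OF finite_bp_support] sum_negf[symmetric] del: sum_negf)
  also have "(\<Sum>x\<in>?S. ?g x) = (\<Sum>x\<in>{..<m} \<times> {..<n}. ?g x)"
  proof (rule sum.mono_neutral_left)
    show "finite ({..<m} \<times> {..<n})" by simp
    show "\<forall>x\<in>{..<m} \<times> {..<n} - ?S. ?g x = 0"
    proof
      fix x assume "x \<in> {..<m} \<times> {..<n} - ?S"
      then obtain i j where x: "x = (i, j)" and ij: "i < m" "j < n" "\<not> 0 < Xb i j" by auto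
      then have "Xb i j = 0" using nonneg by (simp add: antisym)
      then show "?g x = 0" by (simp add: x W0)
    qed
  qed auto
  also have "\<dots> = (\<Sum>a\<in>A. \<Sum>b\<in>{..<m + n} - A. bip_weight m n ?W a b)"
    unfolding bip_cut[OF A] by (simp add: sum.cartesian_product)
  finally show ?thesis .
qed

lemma sum_powers_proper_subsets_le:
  fixes t :: real
  assumes t: "0 \<le> t" and S: "finite S"
  shows "(\<Sum>A\<in>Pow S - {{}, S}. t ^ card A + t ^ card (S - A)) \<le> 2 * ((1 + t) ^ card S - 1)"
proof -
  have fin: "finite (Pow S)" using S by simp
  have "(\<Sum>A\<in>Pow S - {{}, S}. t ^ card A) \<le> (\<Sum>A\<in>Pow S - {{}}. t ^ card A)"
    using t S by (intro sum_mono2) auto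
  also have "\<dots> = (1 + t) ^ card S - 1"
    using prod_add[OF S, of "\<lambda>_. t" "\<lambda>_. 1"] S by (simp add: sum.remove[of "Pow S" "{}"] add.commute)
  finally have 1: "(\<Sum>A\<in>Pow S - {{}, S}. t ^ card A) \<le> (1 + t) ^ card S - 1" .
  have "(\<Sum>A\<in>Pow S - {{}, S}. t ^ card (S - A)) \<le> (\<Sum>A\<in>Pow S - {S}. t ^ card (S - A))"
    using t S by (intro sum_mono2) auto
  also have "\<dots> = (1 + t) ^ card S - 1"
    using prod_add[OF S, of "\<lambda>_. 1" "\<lambda>_. t"] S by (simp add: sum.remove[of "Pow S" S] add.commute)
  finally show ?thesis using 1 by (simp add: sum.distrib)
qed

lemma union_bound_estimate:
  assumes N: "2 \<le> N"
  shows "2 * ((1 + 1 / real N ^ 4) ^ N - 1) \<le> 2 / sqrt (real N)"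
proof -
  define x where "x = 1 / real N ^ 3"
  have N2: "2 \<le> real N" using N by simp
  have x: "0 \<le> x" "x \<le> 1" using N by (auto simp: x_def)
  have "(1 + 1 / real N ^ 4) ^ N \<le> exp (1 / real N ^ 4) ^ N"
    by (intro power_mono exp_ge_add_one_self) auto
  also have "\<dots> = exp x"
    using N by (simp add: exp_of_nat_mult[symmetric] x_def power_eq_if[of _ 4])
  also have "\<dots> \<le> 1 + x + x\<^sup>2" using x by (rule exp_bound)
  also have "\<dots> \<le> 1 + 2 * x" using x by (simp add: power2_eq_square mult_left_le_one_le)
  finally have "2 * ((1 + 1 / real N ^ 4) ^ N - 1) \<le> 4 * x" by simp
  also have "4 * x \<le> 2 / real N"
  proof -
    have "2 * 2 \<le> real N * real N" using N2 by (intro mult_mono) auto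
    then have "4 * real N \<le> 2 * real N ^ 3"
      using N2 by (simp add: power3_eq_cube)
    then show ?thesis using N2 by (simp add: x_def field_simps)
  qed
  also have "\<dots> \<le> 2 / sqrt (real N)"
    using N2 by (intro divide_left_mono real_le_lsqrt) (auto simp: power2_eq_square)
  finally show ?thesis .
qed

lemma cut_exponent_bound:
  assumes lam: "8 * ln (real N) \<le> lam" and k: "0 < k" "k < N"
  shows "exp (- (lam * (real k * real (N - k) / real N))) \<le> (1 / real N ^ 4) ^ k + (1 / real N ^ 4) ^ (N - k)"
proof -
  have N: "0 < real N" "0 \<le> ln (real N)" using k by auto
  have pow: "exp (- (4 * ln (real N) * real l)) = (1 / real N ^ 4) ^ l" for l
  proof -
    have "exp (- (4 * ln (real N) * real l)) = exp (- (real 4 * ln (real N))) ^ l"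
      by (simp add: exp_of_nat_mult[symmetric] mult_ac)
    also have "exp (- (real 4 * ln (real N))) = 1 / real N ^ 4"
      using N by (simp only: exp_minus exp_of_nat_mult exp_ln inverse_eq_divide)
    finally show ?thesis .
  qed
  have half: "exp (- (lam * (real k * real (N - k) / real N))) \<le> (1 / real N ^ 4) ^ l"
    if l: "real l \<le> 2 * (real k * real (N - k) / real N)" for l
  proof -
    have "4 * ln (real N) * real l \<le> 4 * ln (real N) * (2 * (real k * real (N - k) / real N))"
      using N l by (intro mult_left_mono) auto
    also have "\<dots> = 8 * ln (real N) * (real k * real (N - k) / real N)" by simp
    also have "\<dots> \<le> lam * (real k * real (N - k) / real N)"
      using lam by (intro mult_right_mono) auto
    finally show ?thesis unfolding pow[symmetric] by simp
  qed
  show ?thesis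
  proof (cases "real N \<le> 2 * real (N - k)")
    case True
    then have "real k * real N \<le> real k * (2 * real (N - k))" by (intro mult_left_mono) auto
    then have "real k \<le> 2 * (real k * real (N - k) / real N)" using N by (simp add: field_simps)
    from half[OF this] show ?thesis by (simp add: add_increasing2)
  next
    case False
    then have "real N \<le> 2 * real k" using k by simp
    then have "real (N - k) * real N \<le> real (N - k) * (2 * real k)" by (intro mult_left_mono) auto
    then have "real (N - k) \<le> 2 * (real k * real (N - k) / real N)" using N by (simp add: field_simps)
    from half[OF this] show ?thesis by (simp add: add_increasing)
  qed
qed

section \<open>Maximisers of the log-likelihood\<close>

lemma poisson_term_bounded:
  fixes X Y :: real
  assumes "0 \<le> X" "0 \<le> Y" "X = 0 \<Longrightarrow> Y = 0"
  shows "\<exists>C\<ge>0. \<forall>z. Y * z - X * exp z \<le> C"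
proof (cases "Y = 0")
  case True
  then show ?thesis using assms by (intro exI[of _ 0]) auto
next
  case False
  then have pos: "0 < X" "0 < Y" using assms by (auto simp: less_le)
  have "Y * z - X * exp z \<le> \<bar>Y * ln (Y / X)\<bar>" for z
  proof -
    have "Y * (1 + (z - ln (Y / X))) \<le> Y * exp (z - ln (Y / X))"
      using pos by (intro mult_left_mono exp_ge_add_one_self) auto
    also have "\<dots> = X * exp z" using pos by (simp add: exp_diff)
    finally have "Y * z - X * exp z \<le> Y * ln (Y / X) - Y" by (simp add: algebra_simps)
    then show ?thesis using pos by linarith
  qed
  then show ?thesis by (intro exI[of _ "\<bar>Y * ln (Y / X)\<bar>"]) auto
qed

lemma poisson_term_coercive:
  fixes X Y :: real
  assumes "0 < X" "0 \<le> Y"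
  shows "\<exists>B\<ge>0. \<forall>z. - K \<le> Y * z - X * exp z \<longrightarrow> z \<le> B \<and> (0 < Y \<longrightarrow> - B \<le> z)"
proof -
  obtain C where C: "0 \<le> C" "\<And>z. Y * z - X / 2 * exp z \<le> C"
    using poisson_term_bounded[of "X / 2" Y] assms by auto
  define B where "B = \<bar>2 * (C + K) / X\<bar> + \<bar>K / Y\<bar>"
  have "z \<le> B \<and> (0 < Y \<longrightarrow> - B \<le> z)" if z: "- K \<le> Y * z - X * exp z" for z
  proof
    have "X / 2 * z \<le> X / 2 * exp z"
      using assms exp_ge_add_one_self[of z] by (intro mult_left_mono) (linarith, simp)
    then have "X / 2 * z \<le> C + K" using C(2)[of z] z by simp
    then have "z \<le> 2 * (C + K) / X" using assms by (simp add: field_simps)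
    then show "z \<le> B" unfolding B_def by linarith
    show "0 < Y \<longrightarrow> - B \<le> z"
    proof
      assume Y: "0 < Y"
      have "0 < X * exp z" using assms by simp
      then have "- K \<le> Y * z" using z by linarith
      then have "- (K / Y) \<le> z" using Y by (simp add: field_simps)
      then show "- B \<le> z" unfolding B_def by linarith
    qed
  qed
  moreover have "0 \<le> B" by (simp add: B_def)
  ultimately show ?thesis by blast
qed

lemma exp_tangent_unique:
  fixes P S :: real
  assumes "\<And>t. P * t \<le> S * (exp t - 1)"
  shows "P = S"
proof -
  let ?h = "\<lambda>t. S * (exp t - 1) - P * t"
  have "(?h has_real_derivative S * exp 0 - P) (at 0)"
    by (auto intro!: derivative_eq_intros)
  then have "S * exp 0 - P = 0"
    by (rule DERIV_local_min[where d = 1]) (use assms in auto)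
  then show ?thesis by simp
qed

locale unblocked_table =
  fixes m n :: nat and X :: "nat \<Rightarrow> nat \<Rightarrow> real" and Y :: "nat \<times> nat \<Rightarrow> real"
  assumes m: "0 < m" and n: "0 < n"
    and X_nonneg: "\<And>i j. i < m \<Longrightarrow> j < n \<Longrightarrow> 0 \<le> X i j"
    and Y_nonneg: "\<And>i j. i < m \<Longrightarrow> j < n \<Longrightarrow> 0 \<le> Y (i, j)"
    and Y_supp: "\<And>i j. i < m \<Longrightarrow> j < n \<Longrightarrow> X i j = 0 \<Longrightarrow> Y (i, j) = 0"
    and unblocked: "\<And>A. A \<subseteq> {..<m + n} \<Longrightarrow> A \<noteq> {} \<Longrightarrow> A \<noteq> {..<m + n} \<Longrightarrow> \<not> blocked m n X Y A"
begin

definition p :: "nat \<Rightarrow> real" where "p i = (\<Sum>j<n. Y (i, j))"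

definition q :: "nat \<Rightarrow> real" where "q j = (\<Sum>i<m. Y (i, j))"

lemma spread_le:
  fixes x :: "nat \<Rightarrow> real"
  assumes B: "0 \<le> B"
    and down: "\<And>i j. i < m \<Longrightarrow> j < n \<Longrightarrow> 0 < X i j \<Longrightarrow> x i \<le> x (m + j) + B"
    and up: "\<And>i j. i < m \<Longrightarrow> j < n \<Longrightarrow> 0 < Y (i, j) \<Longrightarrow> x (m + j) \<le> x i + B"
    and ab: "a < m + n" "b < m + n"
  shows "x b \<le> x a + real (m + n) * B"
proof -
  define R where "R k = {c. c < m + n \<and> x c \<le> x a + real k * B}" for k :: nat
  have finR: "finite (R k)" for k by (simp add: R_def)
  have sub: "R k \<subseteq> R (Suc k)" for k
    using B by (auto simp: R_def algebra_simps)
  have "min (m + n) (Suc k) \<le> card (R k)" for k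
  proof (induction k)
    case 0
    have "{a} \<subseteq> R 0" using ab by (simp add: R_def)
    from card_mono[OF finR this] show ?case by simp
  next
    case (Suc k)
    show ?case
    proof (cases "R k = {..<m + n}")
      case True
      then have "{..<m + n} \<subseteq> R (Suc k)" using sub by metis
      from card_mono[OF finR this] show ?thesis by simp
    next
      case False
      have "R k \<subseteq> {..<m + n}" "R k \<noteq> {}" using ab B by (auto simp: R_def intro!: exI[of _ a])
      from unblocked[OF this False] obtain i j where ij: "i < m" "j < n"
        and *: "(m + j \<in> R k \<and> i \<notin> R k \<and> X i j \<noteq> 0) \<or> (i \<in> R k \<and> m + j \<notin> R k \<and> Y (i, j) \<noteq> 0)"
        unfolding blocked_def by blast
      from * have "\<exists>c. c \<in> R (Suc k) \<and> c \<notin> R k"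
      proof
        assume h: "m + j \<in> R k \<and> i \<notin> R k \<and> X i j \<noteq> 0"
        then have "0 < X i j" using X_nonneg[OF ij] by simp
        from down[OF ij this] have "i \<in> R (Suc k)" using h ij by (simp add: R_def algebra_simps)
        then show ?thesis using h by blast
      next
        assume h: "i \<in> R k \<and> m + j \<notin> R k \<and> Y (i, j) \<noteq> 0"
        then have "0 < Y (i, j)" using Y_nonneg[OF ij] by simp
        from up[OF ij this] have "m + j \<in> R (Suc k)" using h ij by (simp add: R_def algebra_simps)
        then show ?thesis using h by blast
      qed
      then have "card (R k) < card (R (Suc k))"
        using sub finR by (intro psubset_card_mono) auto
      then show ?thesis using Suc.IH by linarith
    qed
  qed
  from this[of "m + n"] have "card {..<m + n} \<le> card (R (m + n))" by simp
  moreover have "R (m + n) \<subseteq> {..<m + n}" by (auto simp: R_def)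
  ultimately have "R (m + n) = {..<m + n}" by (intro card_seteq) auto
  then show ?thesis using ab(2) by (auto simp: R_def)
qed

lemma edge_spread_le:
  fixes a b :: "nat \<Rightarrow> real"
  assumes "0 \<le> \<epsilon>"
    and "\<And>i j. i < m \<Longrightarrow> j < n \<Longrightarrow> 0 < X i j \<Longrightarrow> \<bar>a i - b j\<bar> \<le> \<epsilon>"
  shows "i < m \<Longrightarrow> \<bar>a i - a 0\<bar> \<le> real (m + n) * \<epsilon>"
    and "j < n \<Longrightarrow> \<bar>b j - a 0\<bar> \<le> real (m + n) * \<epsilon>"
proof -
  define x where "x c = (if c < m then a c else b (c - m))" for c
  have pos: "0 < X i j" if "i < m" "j < n" "0 < Y (i, j)" for i j
    using X_nonneg[of i j] Y_supp[of i j] that by (cases "X i j = 0") auto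
  have le: "x d \<le> x c + real (m + n) * \<epsilon>" if "c < m + n" "d < m + n" for c d
    by (rule spread_le[OF assms(1) _ _ that]) (use assms(2) pos in \<open>force simp: x_def abs_le_iff\<close>)+
  show "\<bar>a i - a 0\<bar> \<le> real (m + n) * \<epsilon>" if "i < m"
    using le[of i 0] le[of 0 i] that m by (simp add: x_def abs_le_iff)
  show "\<bar>b j - a 0\<bar> \<le> real (m + n) * \<epsilon>" if "j < n"
    using le[of "m + j" 0] le[of 0 "m + j"] that m by (simp add: x_def abs_le_iff)
qed

lemma loglik_eq:
  "loglik m n X p q u v = (\<Sum>i<m. \<Sum>j<n. Y (i, j) * (u i - v j) - X i j * exp (u i - v j))"
proof -
  have "(\<Sum>i<m. p i * u i) = (\<Sum>i<m. \<Sum>j<n. Y (i, j) * u i)"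
    by (simp add: p_def sum_distrib_right)
  moreover have "(\<Sum>j<n. q j * v j) = (\<Sum>i<m. \<Sum>j<n. Y (i, j) * v j)"
    by (subst sum.swap) (simp add: q_def sum_distrib_right)
  ultimately show ?thesis
    by (simp add: loglik_def sum_subtractf right_diff_distrib)
qed

lemma superlevel_spread:
  obtains D where "0 \<le> D" and "\<And>u v. loglik m n X p q (\<lambda>_. 0) (\<lambda>_. 0) \<le> loglik m n X p q u v \<Longrightarrow>
     (\<forall>i<m. \<bar>u i - u 0\<bar> \<le> D) \<and> (\<forall>j<n. \<bar>v j - u 0\<bar> \<le> D)"
proof -
  define \<phi> where "\<phi> i j z = Y (i, j) * z - X i j * exp z" for i j z
  let ?I = "{..<m} \<times> {..<n}"
  have "\<forall>e\<in>?I. \<exists>C\<ge>0. \<forall>z. \<phi> (fst e) (snd e) z \<le> C"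
  proof
    fix e assume "e \<in> ?I"
    then have ij: "fst e < m" "snd e < n" by auto
    show "\<exists>C\<ge>0. \<forall>z. \<phi> (fst e) (snd e) z \<le> C"
      unfolding \<phi>_def by (rule poisson_term_bounded[OF X_nonneg[OF ij] Y_nonneg[OF ij] Y_supp[OF ij]])
  qed
  from bchoice[OF this] obtain C where
    C': "\<forall>e\<in>?I. 0 \<le> C e \<and> (\<forall>z. \<phi> (fst e) (snd e) z \<le> C e)" by blast
  then have C: "\<And>e. e \<in> ?I \<Longrightarrow> 0 \<le> C e" "\<And>e z. e \<in> ?I \<Longrightarrow> \<phi> (fst e) (snd e) z \<le> C e"
    by blast+
  define K where "K = sum C ?I - loglik m n X p q (\<lambda>_. 0) (\<lambda>_. 0)"
  have "\<forall>e\<in>?I. \<exists>B\<ge>0. 0 < X (fst e) (snd e) \<longrightarrow> (\<forall>z. - K \<le> \<phi> (fst e) (snd e) z \<longrightarrow>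
      z \<le> B \<and> (0 < Y e \<longrightarrow> - B \<le> z))"
  proof
    fix e assume e: "e \<in> ?I"
    show "\<exists>B\<ge>0. 0 < X (fst e) (snd e) \<longrightarrow> (\<forall>z. - K \<le> \<phi> (fst e) (snd e) z \<longrightarrow>
      z \<le> B \<and> (0 < Y e \<longrightarrow> - B \<le> z))"
    proof (cases "0 < X (fst e) (snd e)")
      case True
      from poisson_term_coercive[OF True, of "Y e" K] show ?thesis
        using e Y_nonneg by (auto simp: \<phi>_def)
    qed auto
  qed
  from bchoice[OF this] obtain B where
    B': "\<forall>e\<in>?I. 0 \<le> B e \<and> (0 < X (fst e) (snd e) \<longrightarrow> (\<forall>z. - K \<le> \<phi> (fst e) (snd e) z \<longrightarrow>
      z \<le> B e \<and> (0 < Y e \<longrightarrow> - B e \<le> z)))" by blast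
  then have B0: "\<And>e. e \<in> ?I \<Longrightarrow> 0 \<le> B e" by blast
  have B: "z \<le> B (i, j) \<and> (0 < Y (i, j) \<longrightarrow> - B (i, j) \<le> z)"
    if "i < m" "j < n" "0 < X i j" "- K \<le> \<phi> i j z" for i j z
    using B'[rule_format, of "(i, j)"] that by simp
  define b where "b = sum B ?I"
  have b0: "0 \<le> b" unfolding b_def by (rule sum_nonneg) (rule B0)
  have Bb: "B (i, j) \<le> b" if "i < m" "j < n" for i j
    unfolding b_def by (rule member_le_sum) (use that B0 in auto)
  show thesis
  proof (rule that)
    show "0 \<le> real (m + n) * b" using b0 by simp
    fix u v assume ge: "loglik m n X p q (\<lambda>_. 0) (\<lambda>_. 0) \<le> loglik m n X p q u v"
    have low: "- K \<le> \<phi> i j (u i - v j)" if ij: "i < m" "j < n" for i j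
    proof -
      have "loglik m n X p q u v = (\<Sum>e\<in>?I. \<phi> (fst e) (snd e) (u (fst e) - v (snd e)))"
        unfolding loglik_eq \<phi>_def by (simp add: sum.cartesian_product split_beta)
      also have "\<dots> = \<phi> i j (u i - v j) + (\<Sum>e\<in>?I - {(i, j)}. \<phi> (fst e) (snd e) (u (fst e) - v (snd e)))"
        using ij by (subst sum.remove[of _ "(i, j)"]) auto
      also have "\<dots> \<le> \<phi> i j (u i - v j) + (\<Sum>e\<in>?I - {(i, j)}. C e)"
        using C(2) by (intro add_left_mono sum_mono) auto
      also have "(\<Sum>e\<in>?I - {(i, j)}. C e) \<le> sum C ?I"
        using C(1) by (intro sum_mono2) auto
      finally show ?thesis using ge by (simp add: K_def)
    qed
    define x where "x c = (if c < m then u c else v (c - m))" for c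
    have pos: "0 < X i j" if "i < m" "j < n" "0 < Y (i, j)" for i j
      using X_nonneg[of i j] Y_supp[of i j] that by (cases "X i j = 0") auto
    have le: "x d \<le> x c + real (m + n) * b" if cd: "c < m + n" "d < m + n" for c d
    proof (rule spread_le[OF b0 _ _ cd])
      fix i j assume ij: "i < m" "j < n"
      show "x i \<le> x (m + j) + b" if "0 < X i j"
        using B[OF ij that low[OF ij]] Bb[OF ij] ij by (simp add: x_def)
      show "x (m + j) \<le> x i + b" if "0 < Y (i, j)"
        using B[OF ij pos[OF ij that] low[OF ij]] Bb[OF ij] ij that by (simp add: x_def)
    qed
    show "(\<forall>i<m. \<bar>u i - u 0\<bar> \<le> real (m + n) * b) \<and> (\<forall>j<n. \<bar>v j - u 0\<bar> \<le> real (m + n) * b)"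
    proof (intro conjI allI impI)
      show "\<bar>u i - u 0\<bar> \<le> real (m + n) * b" if "i < m" for i
        using le[of i 0] le[of 0 i] that m by (simp add: x_def abs_le_iff)
      show "\<bar>v j - u 0\<bar> \<le> real (m + n) * b" if "j < n" for j
        using le[of "m + j" 0] le[of 0 "m + j"] that m by (simp add: x_def abs_le_iff)
    qed
  qed
qed

lemma ex_maximizer: "\<exists>u v. is_maximizer m n X p q u v"
proof -
  obtain D where D: "0 \<le> D" "\<And>u v. loglik m n X p q (\<lambda>_. 0) (\<lambda>_. 0) \<le> loglik m n X p q u v \<Longrightarrow>
     (\<forall>i<m. \<bar>u i - u 0\<bar> \<le> D) \<and> (\<forall>j<n. \<bar>v j - u 0\<bar> \<le> D)"
    by (rule superlevel_spread) (rule that)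
  define F where "F x = loglik m n X p q x (\<lambda>j. x (m + j))" for x
  define K where "K = {x :: nat \<Rightarrow> real. (\<forall>a<m + n. \<bar>x a\<bar> \<le> D) \<and> (\<forall>a\<ge>m + n. x a = 0)}"
  have co: "continuous_on S (\<lambda>x :: nat \<Rightarrow> real. x a)" for S a
    by (rule continuous_on_subset[OF continuous_on_product_coordinates]) auto
  have cont: "continuous_on K F"
    unfolding F_def loglik_def by (intro continuous_intros co)
  have zero: "(\<lambda>_. 0) \<in> K" using D(1) by (simp add: K_def)
  then have "K \<noteq> {}" by blast
  moreover have "compact K" unfolding K_def by (rule compact_box_fun)
  ultimately obtain x where x: "\<And>y. y \<in> K \<Longrightarrow> F y \<le> F x"
    using continuous_attains_sup[OF _ _ cont] by blast
  have "loglik m n X p q u v \<le> F x" for u v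
  proof (cases "loglik m n X p q (\<lambda>_. 0) (\<lambda>_. 0) \<le> loglik m n X p q u v")
    case False
    then show ?thesis using x[OF zero] by (simp add: F_def)
  next
    case True
    define y where "y a = (if a < m then u a - u 0 else if a < m + n then v (a - m) - u 0 else 0)" for a
    have "F y = loglik m n X p q u v"
      unfolding F_def loglik_eq by (simp add: y_def)
    moreover have "y \<in> K" using D(2)[OF True] by (auto simp: y_def K_def)
    ultimately show ?thesis using x[of y] by simp
  qed
  then show ?thesis unfolding is_maximizer_def F_def by blast
qed

lemma maximizer_unique:
  assumes "is_maximizer m n X p q u v" "is_maximizer m n X p q u' v'"
  shows "\<exists>c. (\<forall>i<m. u' i = u i + c) \<and> (\<forall>j<n. v' j = v j + c)"
proof -
  let ?L = "loglik m n X p q"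
  let ?d = "\<lambda>i j. X i j * (exp ((u i - v j) / 2) - exp ((u' i - v' j) / 2))\<^sup>2"
  let ?U = "\<lambda>i. (u i + u' i) / 2" and ?V = "\<lambda>j. (v j + v' j) / 2"
  have midpoint: "2 * (y * ((r + s) / 2) - x * exp ((r + s) / 2)) =
      (y * r - x * exp r) + (y * s - x * exp s) + x * (exp (r / 2) - exp (s / 2))\<^sup>2" for x y r s :: real
  proof -
    have "exp r = exp (r / 2) * exp (r / 2)" "exp s = exp (s / 2) * exp (s / 2)"
      "exp ((r + s) / 2) = exp (r / 2) * exp (s / 2)"
      by (simp_all add: exp_add[symmetric] add_divide_distrib)
    then show ?thesis by (simp add: power2_eq_square algebra_simps)
  qed
  have "2 * ?L ?U ?V = ?L u v + ?L u' v' + (\<Sum>i<m. \<Sum>j<n. ?d i j)"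
  proof -
    have "?U i - ?V j = ((u i - v j) + (u' i - v' j)) / 2" for i j
      by (simp add: field_simps)
    then show ?thesis
      unfolding loglik_eq sum_distrib_left by (simp only: midpoint sum.distrib)
  qed
  moreover have "?L ?U ?V \<le> ?L u v" "?L ?U ?V \<le> ?L u' v'"
    using assms unfolding is_maximizer_def by blast+
  ultimately have "(\<Sum>i<m. \<Sum>j<n. ?d i j) \<le> 0" by linarith
  moreover have nn: "0 \<le> ?d i j" if "i < m" "j < n" for i j
    using X_nonneg[OF that] by simp
  have nn': "0 \<le> (\<Sum>j<n. ?d i j)" if "i < m" for i
    by (rule sum_nonneg) (use that nn in blast)
  have "0 \<le> (\<Sum>i<m. \<Sum>j<n. ?d i j)"
    by (rule sum_nonneg) (use nn' in blast)
  ultimately have "(\<Sum>i<m. \<Sum>j<n. ?d i j) = 0" by linarith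
  then have row0: "(\<Sum>j<n. ?d i j) = 0" if "i < m" for i
    using sum_nonneg_eq_0_iff[OF finite_lessThan, of m "\<lambda>i. \<Sum>j<n. ?d i j"] nn' that by blast
  have d0: "?d i j = 0" if "i < m" "j < n" for i j
    using sum_nonneg_eq_0_iff[OF finite_lessThan, of n "?d i"] row0[OF that(1)] nn[OF that(1)] that(2) by blast
  have edge: "\<bar>(u' i - u i) - (v' j - v j)\<bar> \<le> 0" if "i < m" "j < n" "0 < X i j" for i j
    using d0[OF that(1,2)] that(3) by auto
  have "u' i - u i = u' 0 - u 0" if "i < m" for i
    using edge_spread_le(1)[of 0 "\<lambda>i. u' i - u i" "\<lambda>j. v' j - v j" i] edge that by simp
  moreover have "v' j - v j = u' 0 - u 0" if "j < n" for j
    using edge_spread_le(2)[of 0 "\<lambda>i. u' i - u i" "\<lambda>j. v' j - v j" j] edge that by simp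
  ultimately show ?thesis by (intro exI[of _ "u' 0 - u 0"]) (auto simp: algebra_simps)
qed

lemma row_stationary:
  assumes max: "is_maximizer m n X p q u v" and i: "i < m"
  shows "p i = (\<Sum>j<n. X i j * exp (u i - v j))"
proof (rule exp_tangent_unique)
  fix t
  let ?S = "\<lambda>i. \<Sum>j<n. X i j * exp (u i - v j)"
  let ?u = "u(i := u i + t)"
  have "(\<Sum>k<m. p k * ?u k) = (\<Sum>k<m. p k * u k + (if k = i then p i * t else 0))"
    by (intro sum.cong) (auto simp: algebra_simps)
  also have "\<dots> = (\<Sum>k<m. p k * u k) + p i * t" using i by (simp add: sum.distrib)
  finally have 1: "(\<Sum>k<m. p k * ?u k) = (\<Sum>k<m. p k * u k) + p i * t" .
  have e: "X i j * exp (u i + t - v j) = X i j * exp (u i - v j) * exp t" for j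
    by (simp add: exp_add[symmetric] algebra_simps)
  have "(\<Sum>j<n. X i j * exp (u i + t - v j)) = ?S i + ?S i * (exp t - 1)"
    unfolding e by (simp add: sum_distrib_right[symmetric] right_diff_distrib)
  then have "(\<Sum>k<m. \<Sum>j<n. X k j * exp (?u k - v j)) = (\<Sum>k<m. ?S k + (if k = i then ?S i * (exp t - 1) else 0))"
    by (intro sum.cong refl) auto
  also have "\<dots> = (\<Sum>k<m. ?S k) + ?S i * (exp t - 1)" using i by (simp add: sum.distrib)
  finally have 2: "(\<Sum>k<m. \<Sum>j<n. X k j * exp (?u k - v j)) = (\<Sum>k<m. ?S k) + ?S i * (exp t - 1)" .
  have "loglik m n X p q ?u v \<le> loglik m n X p q u v"
    using max unfolding is_maximizer_def by blast
  then show "p i * t \<le> ?S i * (exp t - 1)"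
    unfolding loglik_def 1 2 by linarith
qed

lemma col_stationary:
  assumes max: "is_maximizer m n X p q u v" and j: "j < n"
  shows "q j = (\<Sum>i<m. X i j * exp (u i - v j))"
proof (rule exp_tangent_unique)
  fix t
  let ?S = "\<lambda>j. \<Sum>i<m. X i j * exp (u i - v j)"
  let ?v = "v(j := v j - t)"
  have "(\<Sum>k<n. q k * ?v k) = (\<Sum>k<n. q k * v k - (if k = j then q j * t else 0))"
    by (intro sum.cong) (auto simp: algebra_simps)
  also have "\<dots> = (\<Sum>k<n. q k * v k) - q j * t" using j by (simp add: sum_subtractf)
  finally have 1: "(\<Sum>k<n. q k * ?v k) = (\<Sum>k<n. q k * v k) - q j * t" .
  have e: "X i j * exp (u i - (v j - t)) = X i j * exp (u i - v j) * exp t" for i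
    by (simp add: exp_add[symmetric] algebra_simps)
  have "(\<Sum>i<m. X i j * exp (u i - (v j - t))) = ?S j + ?S j * (exp t - 1)"
    unfolding e by (simp add: sum_distrib_right[symmetric] right_diff_distrib)
  then have "(\<Sum>k<n. \<Sum>i<m. X i k * exp (u i - ?v k)) = (\<Sum>k<n. ?S k + (if k = j then ?S j * (exp t - 1) else 0))"
    by (intro sum.cong refl) auto
  also have "\<dots> = (\<Sum>k<n. ?S k) + ?S j * (exp t - 1)" using j by (simp add: sum.distrib)
  finally have 2: "(\<Sum>i<m. \<Sum>k<n. X i k * exp (u i - ?v k)) = (\<Sum>i<m. \<Sum>k<n. X i k * exp (u i - v k)) + ?S j * (exp t - 1)"
    by (simp only: sum.swap[of _ "{..<n}" "{..<m}"])
  have "loglik m n X p q u ?v \<le> loglik m n X p q u v"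
    using max unfolding is_maximizer_def by blast
  then show "q j * t \<le> ?S j * (exp t - 1)"
    unfolding loglik_def 1 2 by linarith
qed

lemma p_pos:
  assumes i: "i < m"
  shows "0 < p i"
proof -
  have "m \<in> {..<m + n} - {i}" "i \<in> {..<m + n}" using i n by auto
  then have "\<not> blocked m n X Y {i}" by (intro unblocked) blast+
  then obtain j where j: "j < n" "Y (i, j) \<noteq> 0" using i unfolding blocked_def by auto
  then have "0 < Y (i, j)" using Y_nonneg[OF i j(1)] by simp
  also have "\<dots> \<le> p i" unfolding p_def by (rule member_le_sum) (use i j Y_nonneg in auto)
  finally show ?thesis .
qed

lemma q_pos:
  assumes j: "j < n"
  shows "0 < q j"
proof -
  have "0 \<in> {..<m + n} - {m + j}" "m + j \<in> {..<m + n}" using j m by auto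
  then have "\<not> blocked m n X Y ({..<m + n} - {m + j})" by (intro unblocked) blast+
  then obtain i where i: "i < m" "Y (i, j) \<noteq> 0" using j unfolding blocked_def by auto
  then have "0 < Y (i, j)" using Y_nonneg[OF i(1) j] by simp
  also have "\<dots> \<le> q j" unfolding q_def by (rule member_le_sum) (use i j Y_nonneg in auto)
  finally show ?thesis .
qed

end

section \<open>Convergence of IPF\<close>

lemma weighted_average_bounds:
  fixes w b :: "nat \<Rightarrow> real"
  assumes w: "\<And>j. j < n \<Longrightarrow> 0 \<le> w j" and P: "P = (\<Sum>j<n. w j)" "0 < P"
    and b: "\<And>j. j < n \<Longrightarrow> lo \<le> b j \<and> b j \<le> hi"
  shows "lo \<le> (\<Sum>j<n. w j * b j) / P" "(\<Sum>j<n. w j * b j) / P \<le> hi"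
proof -
  have "(\<Sum>j<n. w j * lo) \<le> (\<Sum>j<n. w j * b j)" "(\<Sum>j<n. w j * b j) \<le> (\<Sum>j<n. w j * hi)"
    using w b by (auto intro!: sum_mono mult_left_mono)
  then have "lo * P \<le> (\<Sum>j<n. w j * b j)" "(\<Sum>j<n. w j * b j) \<le> hi * P"
    unfolding P(1) sum_distrib_right[symmetric] by (simp_all add: mult.commute)
  then show "lo \<le> (\<Sum>j<n. w j * b j) / P" "(\<Sum>j<n. w j * b j) / P \<le> hi"
    using P(2) by (simp_all add: pos_le_divide_eq pos_divide_le_eq)
qed

context unblocked_table
begin

lemma alternating_averages_converge:
  fixes W :: "nat \<Rightarrow> nat \<Rightarrow> real" and a b :: "nat \<Rightarrow> nat \<Rightarrow> real"
  assumes W0: "\<And>i j. i < m \<Longrightarrow> j < n \<Longrightarrow> 0 \<le> W i j"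
    and Wpos: "\<And>i j. i < m \<Longrightarrow> j < n \<Longrightarrow> 0 < X i j \<Longrightarrow> 0 < W i j"
    and pW: "\<And>i. i < m \<Longrightarrow> p i = (\<Sum>j<n. W i j)"
    and qW: "\<And>j. j < n \<Longrightarrow> q j = (\<Sum>i<m. W i j)"
    and a: "\<And>k i. i < m \<Longrightarrow> a k i = (\<Sum>j<n. W i j * b k j) / p i"
    and b: "\<And>k j. j < n \<Longrightarrow> b (Suc k) j = q j / (\<Sum>i<m. W i j / a k i)"
    and b0: "\<And>j. j < n \<Longrightarrow> 0 < b 0 j"
  obtains c where "0 < c" "\<And>i. i < m \<Longrightarrow> (\<lambda>k. a k i) \<longlonglongrightarrow> c" "\<And>j. j < n \<Longrightarrow> (\<lambda>k. b k j) \<longlonglongrightarrow> c"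
proof -
  have a_bounds: "lo \<le> a k i \<and> a k i \<le> hi"
    if "i < m" "\<And>j. j < n \<Longrightarrow> lo \<le> b k j \<and> b k j \<le> hi" for lo hi k i
    unfolding a[OF that(1)]
    using weighted_average_bounds[of n "W i" "p i" lo "b k" hi] W0[OF that(1)] pW[OF that(1)]
      p_pos[OF that(1)] that(2) by blast
  have b_bounds: "lo \<le> b (Suc k) j \<and> b (Suc k) j \<le> hi"
    if lo: "0 < lo" and j: "j < n" and bd: "\<And>i. i < m \<Longrightarrow> lo \<le> a k i \<and> a k i \<le> hi" for lo hi k j
  proof -
    have hi: "0 < hi" using lo bd[OF m] by linarith
    let ?r = "(\<Sum>i<m. W i j * (1 / a k i)) / q j"
    have inv: "1 / hi \<le> 1 / a k i \<and> 1 / a k i \<le> 1 / lo" if "i < m" for i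
      using bd[OF that] lo by (auto intro!: divide_left_mono mult_pos_pos)
    have "1 / hi \<le> ?r" "?r \<le> 1 / lo"
      using weighted_average_bounds[of m "\<lambda>i. W i j" "q j" "1 / hi" "\<lambda>i. 1 / a k i" "1 / lo"]
        W0[OF _ j] qW[OF j] q_pos[OF j] inv by blast+
    moreover from this(1) have "0 < ?r" using hi by (meson less_le_trans zero_less_divide_1_iff)
    moreover have "b (Suc k) j = 1 / ?r" by (simp add: b[OF j])
    moreover have "lo \<le> 1 / r \<and> 1 / r \<le> hi" if "1 / hi \<le> r" "r \<le> 1 / lo" "0 < r" for r
      using that lo hi by (simp add: field_simps)
    ultimately show ?thesis by metis
  qed
  define lo where "lo = Min (b 0 ` {..<n})"
  define hi where "hi = Max (b 0 ` {..<n})"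
  have "lo \<in> b 0 ` {..<n}" unfolding lo_def using n by (intro Min_in) auto
  then have lo: "0 < lo" using b0 by auto
  have b_in: "j < n \<Longrightarrow> lo \<le> b k j \<and> b k j \<le> hi" for j k
  proof (induction k arbitrary: j)
    case 0
    then show ?case by (auto simp: lo_def hi_def)
  next
    case (Suc k)
    show ?case by (rule b_bounds[OF lo Suc.prems]) (rule a_bounds, use Suc.IH in auto)
  qed
  have a_in: "lo \<le> a k i \<and> a k i \<le> hi" if "i < m" for k i
    by (rule a_bounds[OF that b_in])
  have later: "(\<forall>j<n. l \<le> b k' j \<and> b k' j \<le> h) \<and> (\<forall>i<m. l \<le> a k' i \<and> a k' i \<le> h)"
    if l: "0 < l" and k: "k \<le> k'" and "\<And>j. j < n \<Longrightarrow> l \<le> b k j \<and> b k j \<le> h" for l h k k'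
  proof -
    have "\<forall>j<n. l \<le> b k' j \<and> b k' j \<le> h"
      using k
    proof (induction k' rule: dec_induct)
      case base
      then show ?case using that(3) by blast
    next
      case (step k')
      show ?case
      proof (intro allI impI)
        fix j assume j: "j < n"
        show "l \<le> b (Suc k') j \<and> b (Suc k') j \<le> h"
          by (rule b_bounds[OF l j], rule a_bounds) (use step.IH in auto)
      qed
    qed
    then show ?thesis using a_bounds[of _ l k' h] by blast
  qed
  \<comment> \<open>The passage from \<open>b k\<close> to \<open>a k\<close> preserves the weighted total \<open>H\<close>, while the harmonic means
    \<open>b (Suc k)\<close> lower it by exactly a sum of squared discrepancies across edges.\<close>
  define H where "H k = (\<Sum>j<n. q j * b k j)" for k
  have drop: "H k - H (Suc k) = (\<Sum>i<m. \<Sum>j<n. W i j * (a k i - b (Suc k) j)\<^sup>2 / a k i)" for k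
  proof -
    have "H k = (\<Sum>i<m. \<Sum>j<n. W i j * b k j)"
      by (subst sum.swap) (simp add: H_def qW sum_distrib_right)
    also have "\<dots> = (\<Sum>i<m. p i * a k i)"
    proof (rule sum.cong[OF refl])
      fix i assume "i \<in> {..<m}"
      then show "(\<Sum>j<n. W i j * b k j) = p i * a k i" using a p_pos[of i] by simp
    qed
    also have "\<dots> = (\<Sum>j<n. \<Sum>i<m. W i j * a k i)"
      by (subst sum.swap) (simp add: pW sum_distrib_right)
    finally have "H k - H (Suc k) = (\<Sum>j<n. (\<Sum>i<m. W i j * a k i) - q j * b (Suc k) j)"
      by (simp add: H_def sum_subtractf)
    also have "\<dots> = (\<Sum>j<n. \<Sum>i<m. W i j * (a k i - b (Suc k) j)\<^sup>2 / a k i)"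
    proof (rule sum.cong[OF refl])
      fix j assume "j \<in> {..<n}"
      then have j: "j < n" by simp
      let ?b = "b (Suc k) j" and ?s = "\<Sum>i<m. W i j / a k i"
      have "0 < ?b" using b_in[OF j, of "Suc k"] lo by linarith
      then have "?s \<noteq> 0" unfolding b[OF j] by auto
      then have sb: "?s * ?b = q j" unfolding b[OF j] by simp
      have "(\<Sum>i<m. W i j * (a k i - ?b)\<^sup>2 / a k i) =
          (\<Sum>i<m. W i j * a k i - 2 * ?b * W i j + ?b\<^sup>2 * (W i j / a k i))"
      proof (rule sum.cong[OF refl])
        fix i assume "i \<in> {..<m}"
        then have "0 < a k i" using a_in[of i k] lo by fastforce
        then show "W i j * (a k i - ?b)\<^sup>2 / a k i = W i j * a k i - 2 * ?b * W i j + ?b\<^sup>2 * (W i j / a k i)"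
          by (simp add: field_simps power2_eq_square)
      qed
      also have "\<dots> = (\<Sum>i<m. W i j * a k i) - 2 * ?b * q j + ?b\<^sup>2 * ?s"
        by (simp add: sum.distrib sum_subtractf sum_distrib_left qW[OF j])
      also have "?b\<^sup>2 * ?s = ?b * q j" unfolding sb[symmetric] by (simp add: power2_eq_square)
      finally show "(\<Sum>i<m. W i j * a k i) - q j * ?b = (\<Sum>i<m. W i j * (a k i - ?b)\<^sup>2 / a k i)"
        by simp
    qed
    finally show ?thesis by (subst sum.swap)
  qed
  have term0: "0 \<le> W i j * (a k i - b (Suc k) j)\<^sup>2 / a k i" if "i < m" "j < n" for i j k
    using W0[OF that] a_in[OF that(1), of k] lo by simp
  have "decseq H"
  proof (rule decseq_SucI)
    fix k
    have "0 \<le> H k - H (Suc k)" unfolding drop by (intro sum_nonneg) (use term0 in auto)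
    then show "H (Suc k) \<le> H k" by simp
  qed
  moreover have "0 \<le> H k" for k
    unfolding H_def
  proof (rule sum_nonneg)
    fix j assume "j \<in> {..<n}"
    then show "0 \<le> q j * b k j" using b_in[of j k] q_pos[of j] lo by simp
  qed
  ultimately obtain L where L: "H \<longlonglongrightarrow> L"
    using decseq_convergent[of H 0] by blast
  have H0: "(\<lambda>k. H k - H (Suc k)) \<longlonglongrightarrow> 0"
    using tendsto_diff[OF L LIMSEQ_Suc[OF L]] by simp
  have edge: "(\<lambda>k. \<bar>a k i - b (Suc k) j\<bar>) \<longlonglongrightarrow> 0" if ij: "i < m" "j < n" "0 < X i j" for i j
  proof -
    have w: "0 < W i j" by (rule Wpos[OF ij])
    have hi: "0 < hi" using a_in[OF ij(1), of 0] lo by linarith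
    have le: "(a k i - b (Suc k) j)\<^sup>2 \<le> hi / W i j * (H k - H (Suc k))" for k
    proof -
      have pos: "0 < a k i" using a_in[OF ij(1), of k] lo by linarith
      have "W i j * (a k i - b (Suc k) j)\<^sup>2 / a k i \<le> (\<Sum>j<n. W i j * (a k i - b (Suc k) j)\<^sup>2 / a k i)"
        by (rule member_le_sum) (use ij term0 in auto)
      also have "\<dots> \<le> (\<Sum>i<m. \<Sum>j<n. W i j * (a k i - b (Suc k) j)\<^sup>2 / a k i)"
        by (rule member_le_sum) (use ij term0 in \<open>auto intro!: sum_nonneg\<close>)
      finally have "W i j * (a k i - b (Suc k) j)\<^sup>2 / a k i \<le> H k - H (Suc k)" unfolding drop .
      moreover have "W i j * (a k i - b (Suc k) j)\<^sup>2 / hi \<le> W i j * (a k i - b (Suc k) j)\<^sup>2 / a k i"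
        using a_in[OF ij(1), of k] pos hi w by (intro divide_left_mono) auto
      ultimately have "W i j * (a k i - b (Suc k) j)\<^sup>2 / hi \<le> H k - H (Suc k)" by linarith
      then show ?thesis using w hi by (simp add: field_simps)
    qed
    have "(\<lambda>k. (a k i - b (Suc k) j)\<^sup>2) \<longlonglongrightarrow> 0"
      by (rule tendsto_sandwich[OF _ _ tendsto_const tendsto_mult_right_zero[OF H0, of "hi / W i j"]])
        (use le in auto)
    then have "(\<lambda>k. sqrt ((a k i - b (Suc k) j)\<^sup>2)) \<longlonglongrightarrow> sqrt 0" by (rule tendsto_real_sqrt)
    then show ?thesis by simp
  qed
  have settle: "\<exists>K c. 0 < c \<and> (\<forall>k\<ge>K. (\<forall>j<n. \<bar>b k j - c\<bar> \<le> e) \<and> (\<forall>i<m. \<bar>a k i - c\<bar> \<le> e))"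
    if e: "0 < e" "e < lo" for e
  proof -
    define d where "d = e / real (m + n)"
    have d: "0 < d" "real (m + n) * d = e" using e m by (auto simp: d_def)
    have "\<forall>\<^sub>F k in sequentially. \<forall>x\<in>{(i, j). i < m \<and> j < n \<and> 0 < X i j}.
        \<bar>a k (fst x) - b (Suc k) (snd x)\<bar> < d"
      by (rule eventually_ball_finite[OF finite_bp_support])
        (use order_tendstoD(2)[OF edge d(1)] in auto)
    then obtain K where K': "\<forall>k\<ge>K. \<forall>x\<in>{(i, j). i < m \<and> j < n \<and> 0 < X i j}.
        \<bar>a k (fst x) - b (Suc k) (snd x)\<bar> < d"
      unfolding eventually_sequentially by blast
    have K: "\<bar>a K i - b (Suc K) j\<bar> \<le> d" if "i < m" "j < n" "0 < X i j" for i j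
      using K'[rule_format, of K "(i, j)"] that by simp
    have near: "a K 0 - e \<le> b (Suc K) j \<and> b (Suc K) j \<le> a K 0 + e" if "j < n" for j
    proof -
      have "\<bar>b (Suc K) j - a K 0\<bar> \<le> real (m + n) * d"
        using d(1) that by (intro edge_spread_le(2)) (simp_all add: K)
      then show ?thesis unfolding d(2) by linarith
    qed
    have "0 < a K 0 - e" using a_in[OF m, of K] e by linarith
    from later[OF this _ near] a_in[OF m, of K] lo show ?thesis
      by (intro exI[of _ "Suc K"] exI[of _ "a K 0"]) (auto simp: abs_le_iff algebra_simps)
  qed
  have close: "\<exists>K. \<forall>k\<ge>K. \<forall>k'\<ge>K. (\<forall>j<n. \<bar>b k j - b k' 0\<bar> < e) \<and> (\<forall>i<m. \<bar>a k i - b k' 0\<bar> < e)"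
    if e: "0 < e" for e
  proof -
    define d where "d = min (e / 3) (lo / 2)"
    have d: "0 < d" "d < lo" "2 * d < e" using e lo by (auto simp: d_def)
    from settle[OF d(1,2)] obtain K c where
      K: "\<And>k. K \<le> k \<Longrightarrow> (\<forall>j<n. \<bar>b k j - c\<bar> \<le> d) \<and> (\<forall>i<m. \<bar>a k i - c\<bar> \<le> d)" by blast
    have "\<bar>b k j - b k' 0\<bar> < e" if "K \<le> k" "K \<le> k'" "j < n" for k k' j
    proof -
      have "\<bar>b k j - c\<bar> \<le> d" "\<bar>b k' 0 - c\<bar> \<le> d" using K that n by blast+
      then show ?thesis using d(3) by linarith
    qed
    moreover have "\<bar>a k i - b k' 0\<bar> < e" if "K \<le> k" "K \<le> k'" "i < m" for k k' i
    proof -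
      have "\<bar>a k i - c\<bar> \<le> d" "\<bar>b k' 0 - c\<bar> \<le> d" using K that n by blast+
      then show ?thesis using d(3) by linarith
    qed
    ultimately show ?thesis by blast
  qed
  have "Cauchy (\<lambda>k. b k 0)"
    unfolding Cauchy_def dist_real_def
  proof (intro allI impI)
    fix e :: real assume "0 < e"
    from close[OF this] show "\<exists>M. \<forall>k\<ge>M. \<forall>k'\<ge>M. \<bar>b k 0 - b k' 0\<bar> < e" using n by blast
  qed
  then obtain c where c: "(\<lambda>k. b k 0) \<longlonglongrightarrow> c" by (auto simp: Cauchy_convergent_iff convergent_def)
  have lim: "f \<longlonglongrightarrow> c" if "\<And>e. 0 < e \<Longrightarrow> \<exists>K. \<forall>k\<ge>K. \<bar>f k - b k 0\<bar> < e" for f :: "nat \<Rightarrow> real"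
  proof -
    have "(\<lambda>k. f k - b k 0) \<longlonglongrightarrow> 0" using that by (intro LIMSEQ_I) auto
    from tendsto_add[OF this c] show ?thesis by simp
  qed
  show thesis
  proof (rule that[of c])
    have "lo \<le> c" by (rule LIMSEQ_le_const[OF c]) (use b_in n in blast)
    then show "0 < c" using lo by simp
    show "(\<lambda>k. a k i) \<longlonglongrightarrow> c" if i: "i < m" for i
    proof (rule lim)
      fix e :: real assume "0 < e"
      from close[OF this] show "\<exists>K. \<forall>k\<ge>K. \<bar>a k i - b k 0\<bar> < e" using i by blast
    qed
    show "(\<lambda>k. b k j) \<longlonglongrightarrow> c" if j: "j < n" for j
    proof (rule lim)
      fix e :: real assume "0 < e"
      from close[OF this] show "\<exists>K. \<forall>k\<ge>K. \<bar>b k j - b k 0\<bar> < e" using j by blast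
    qed
  qed
qed

lemma ipf_converges:
  assumes max: "is_maximizer m n X p q u v"
  obtains c where "\<And>i. i < m \<Longrightarrow> (\<lambda>k. ln (fst (ipf m n X p q k) i)) \<longlonglongrightarrow> u i + c"
    "\<And>j. j < n \<Longrightarrow> (\<lambda>k. - ln (snd (ipf m n X p q k) j)) \<longlonglongrightarrow> v j + c"
proof -
  \<comment> \<open>In logarithms, \<open>a\<close> and \<open>b\<close> are the errors of the iterates relative to the maximiser, with sign
    chosen so that one half-step is an arithmetic and the other a harmonic mean.\<close>
  define W where "W i j = X i j * exp (u i - v j)" for i j
  define d0 where "d0 k = fst (ipf m n X p q k)" for k
  define d1 where "d1 k = snd (ipf m n X p q k)" for k
  define a where "a k i = exp (u i) / d0 (Suc k) i" for k i
  define b where "b k j = d1 k j * exp (v j)" for k j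
  have d0: "d0 (Suc k) i = p i / (\<Sum>j<n. X i j * d1 k j)" for k i
    by (simp add: d0_def d1_def Let_def)
  have d1: "d1 (Suc k) j = q j / (\<Sum>i<m. X i j * d0 (Suc k) i)" for k j
    by (simp add: d0_def d1_def Let_def)
  have "\<exists>c>0. (\<forall>i<m. (\<lambda>k. a k i) \<longlonglongrightarrow> c) \<and> (\<forall>j<n. (\<lambda>k. b k j) \<longlonglongrightarrow> c)"
  proof (rule alternating_averages_converge[of W a b])
    show "0 \<le> W i j" if "i < m" "j < n" for i j
      using X_nonneg[OF that] by (simp add: W_def)
    show "0 < W i j" if "0 < X i j" for i j
      using that by (simp add: W_def)
    show "p i = (\<Sum>j<n. W i j)" if "i < m" for i
      unfolding W_def by (rule row_stationary[OF max that])
    show "q j = (\<Sum>i<m. W i j)" if "j < n" for j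
      unfolding W_def by (rule col_stationary[OF max that])
    show "a k i = (\<Sum>j<n. W i j * b k j) / p i" for k i
    proof -
      have "(\<Sum>j<n. W i j * b k j) = exp (u i) * (\<Sum>j<n. X i j * d1 k j)"
        unfolding sum_distrib_left by (intro sum.cong refl) (simp add: W_def b_def exp_diff)
      then show ?thesis by (simp add: a_def d0)
    qed
    show "b (Suc k) j = q j / (\<Sum>i<m. W i j / a k i)" for k j
    proof -
      have "(\<Sum>i<m. W i j / a k i) = (\<Sum>i<m. X i j * d0 (Suc k) i) / exp (v j)"
        unfolding sum_divide_distrib by (intro sum.cong refl) (simp add: W_def a_def exp_diff)
      then show ?thesis by (simp add: b_def d1)
    qed
    show "0 < b 0 j" for j by (simp add: b_def d1_def)
  qed blast
  then obtain c where c: "0 < c" and ac: "\<And>i. i < m \<Longrightarrow> (\<lambda>k. a k i) \<longlonglongrightarrow> c"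
    and bc: "\<And>j. j < n \<Longrightarrow> (\<lambda>k. b k j) \<longlonglongrightarrow> c" by blast
  show thesis
  proof (rule that[of "- ln c"])
    fix i assume i: "i < m"
    have "(\<lambda>k. ln (exp (u i) / a k i)) \<longlonglongrightarrow> ln (exp (u i) / c)"
      using c by (intro tendsto_intros ac i) auto
    also have "(\<lambda>k. ln (exp (u i) / a k i)) = (\<lambda>k. ln (d0 (Suc k) i))"
      by (simp add: a_def)
    also have "ln (exp (u i) / c) = u i + - ln c" using c by (simp add: ln_div)
    finally show "(\<lambda>k. ln (fst (ipf m n X p q k) i)) \<longlonglongrightarrow> u i + - ln c"
      unfolding d0_def by (rule LIMSEQ_imp_Suc)
  next
    fix j assume j: "j < n"
    have "(\<lambda>k. - ln (b k j / exp (v j))) \<longlonglongrightarrow> - ln (c / exp (v j))"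
      using c by (intro tendsto_intros bc j) auto
    moreover have "- ln (c / exp (v j)) = v j + - ln c" using c by (simp add: ln_div)
    ultimately show "(\<lambda>k. - ln (snd (ipf m n X p q k) j)) \<longlonglongrightarrow> v j + - ln c"
      by (simp add: b_def d1_def)
  qed
qed

lemma is_maximizer_shift:
  assumes "is_maximizer m n X p q u v"
  shows "is_maximizer m n X p q (\<lambda>i. u i + c) (\<lambda>j. v j + c)"
  using assms unfolding is_maximizer_def loglik_eq by simp

lemma good_event: "bp_good_event m n X p q"
proof -
  obtain u v where max: "is_maximizer m n X p q u v" using ex_maximizer by blast
  from ipf_converges[OF max] obtain c where
    c: "\<And>i. i < m \<Longrightarrow> (\<lambda>k. ln (fst (ipf m n X p q k) i)) \<longlonglongrightarrow> u i + c"
    "\<And>j. j < n \<Longrightarrow> (\<lambda>k. - ln (snd (ipf m n X p q k) j)) \<longlonglongrightarrow> v j + c" by blast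
  have max': "is_maximizer m n X p q (\<lambda>i. u i + c) (\<lambda>j. v j + c)"
    by (rule is_maximizer_shift[OF max])
  show ?thesis
    unfolding bp_good_event_def
    by (rule exI[of _ "\<lambda>i. u i + c"], rule exI[of _ "\<lambda>j. v j + c"])
      (use max' maximizer_unique[OF max'] c in blast)
qed

end

lemma good_event_if_unblocked:
  assumes "1 \<le> m" "1 \<le> n" and X: "\<forall>i<m. \<forall>j<n. 0 \<le> Xb i j"
    and Y: "Y \<in> set_pmf (bp_poisson_model m n Xb u v)"
    and unblocked: "\<And>A. A \<subseteq> {..<m + n} \<Longrightarrow> A \<noteq> {} \<Longrightarrow> A \<noteq> {..<m + n} \<Longrightarrow> \<not> blocked m n Xb Y A"
  shows "bp_good_event m n Xb (row_sums n Y) (col_sums m Y)"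
proof -
  interpret unblocked_table m n Xb "\<lambda>e. real (Y e)"
  proof
    show "Xb i j = 0 \<Longrightarrow> real (Y (i, j)) = 0" for i j
      using Y set_Pi_pmf_subset[OF finite_bp_support] unfolding bp_poisson_model_def by fastforce
    show "\<not> blocked m n Xb (\<lambda>e. real (Y e)) A"
      if "A \<subseteq> {..<m + n}" "A \<noteq> {}" "A \<noteq> {..<m + n}" for A
      using unblocked[OF that] by (simp add: blocked_def)
  qed (use assms in auto)
  have "row_sums n Y = p" "col_sums m Y = q"
    by (simp_all add: fun_eq_iff row_sums_def col_sums_def p_def q_def)
  then show ?thesis using good_event by simp
qed

theorem mainTheorem5:
  fixes m n :: nat and Xb :: "nat \<Rightarrow> nat \<Rightarrow> real" and us vs :: "nat \<Rightarrow> real"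
  assumes "1 \<le> m" and "1 \<le> n"
    and "\<forall>i<m. \<forall>j<n. 0 \<le> Xb i j"
    and "lambda_second_smallest (bp_laplacian m n (bp_weight Xb us vs)) \<ge> 8 * ln (real (m + n))"
  shows "measure_pmf.prob (bp_poisson_model m n Xb us vs)
           {Y. bp_good_event m n Xb (row_sums n Y) (col_sums m Y)}
         \<ge> 1 - 2 / sqrt (real (m + n))"
proof -
  let ?N = "m + n" and ?M = "bp_poisson_model m n Xb us vs"
  let ?w = "bip_weight m n (bp_weight Xb us vs)"
  let ?G = "{Y. bp_good_event m n Xb (row_sums n Y) (col_sums m Y)}"
  let ?P = "Pow {..<?N} - {{}, {..<?N}}"
  let ?t = "1 / real ?N ^ 4"
  have N: "2 \<le> ?N" using assms by simp
  have sym: "?w a b = ?w b a" for a b by (auto simp: bip_weight_def)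
  have nonneg: "0 \<le> ?w a b" for a b
    using assms(3) by (auto simp: bip_weight_def bp_weight_def)
  have each: "measure_pmf.prob ?M {Y. blocked m n Xb Y A} \<le> ?t ^ card A + ?t ^ card ({..<?N} - A)"
    if "A \<in> ?P" for A
  proof -
    have A: "A \<subseteq> {..<?N}" "A \<noteq> {}" "A \<noteq> {..<?N}" using that by auto
    have fin: "finite A" using A(1) by (rule finite_subset) simp
    have card: "0 < card A" "card A < ?N" "card ({..<?N} - A) = ?N - card A"
      using A fin psubset_card_mono[of "{..<?N}" A] by (auto simp: card_gt_0_iff card_Diff_subset)
    have "measure_pmf.prob ?M {Y. blocked m n Xb Y A} \<le> exp (- (\<Sum>a\<in>A. \<Sum>b\<in>{..<?N} - A. ?w a b))"
      by (rule prob_blocked_le[OF A(1) assms(3)])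
    also have "\<dots> \<le> exp (- (lambda_second_smallest (graph_laplacian ?N ?w) *
        (real (card A) * real (?N - card A) / real ?N)))"
      using second_eigenvalue_le_cut[OF sym nonneg A] by simp
    also have "\<dots> \<le> ?t ^ card A + ?t ^ (?N - card A)"
      using assms(4) card by (intro cut_exponent_bound) (simp_all add: bp_laplacian_eq)
    finally show ?thesis unfolding card(3) .
  qed
  have "measure_pmf.prob ?M (- ?G) = measure_pmf.prob ?M (- ?G \<inter> set_pmf ?M)"
    by (simp add: measure_Int_set_pmf)
  also have "\<dots> \<le> measure_pmf.prob ?M (\<Union>A\<in>?P. {Y. blocked m n Xb Y A})"
  proof (rule measure_pmf.finite_measure_mono)
    show "- ?G \<inter> set_pmf ?M \<subseteq> (\<Union>A\<in>?P. {Y. blocked m n Xb Y A})"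
    proof
      fix Y assume Y: "Y \<in> - ?G \<inter> set_pmf ?M"
      show "Y \<in> (\<Union>A\<in>?P. {Y. blocked m n Xb Y A})"
      proof (rule ccontr)
        assume "Y \<notin> (\<Union>A\<in>?P. {Y. blocked m n Xb Y A})"
        then have "\<not> blocked m n Xb Y A" if "A \<subseteq> {..<?N}" "A \<noteq> {}" "A \<noteq> {..<?N}" for A
          using that by blast
        with Y good_event_if_unblocked[OF assms(1-3)] show False by blast
      qed
    qed
  qed simp
  also have "\<dots> \<le> (\<Sum>A\<in>?P. measure_pmf.prob ?M {Y. blocked m n Xb Y A})"
    by (rule measure_pmf.finite_measure_subadditive_finite) simp_all
  also have "\<dots> \<le> (\<Sum>A\<in>?P. ?t ^ card A + ?t ^ card ({..<?N} - A))"
    by (rule sum_mono) (rule each)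
  also have "\<dots> \<le> 2 * ((1 + ?t) ^ card {..<?N} - 1)"
    by (rule sum_powers_proper_subsets_le) auto
  also have "\<dots> \<le> 2 / sqrt (real ?N)"
    using union_bound_estimate[OF N] by simp
  finally have "measure_pmf.prob ?M (- ?G) \<le> 2 / sqrt (real ?N)" .
  moreover have "measure_pmf.prob ?M (- ?G) = 1 - measure_pmf.prob ?M ?G"
    using measure_pmf.prob_compl[of ?G ?M] by (simp add: Compl_eq_Diff_UNIV)
  ultimately show ?thesis by linarith
qed

end
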